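(* Let $\Gamma$ be a finitely generated discrete group and $S$ a finite generating set of $\Gamma$. Let $B$ be a $p$-uniformly smooth Banach space and let $(\pi,B)$ be a uniformly bounded representation of $\Gamma$ on $B$. If $\Gamma$ admits a cocycle $b:\Gamma\to B$ with coefficients in $(\pi,B)$ such that $\|b(g)\|\succ |g|_S^{1/p}$ (that is, for every $\varepsilon>0$ there is a finite subset $F\subset\Gamma$ such that $|g|_S^{1/p}\le \varepsilon\,\|b(g)\|$ for all $g\in\Gamma\setminus F$), then $\Gamma$ is amenable.
   Context: The modulus of uniform smoothness of a Banach space $B$ is, for $\tau>0$, $\rho_B(\tau)=\sup\{\frac{\|u+v\|+\|u-v\|}{2}-1 : \|u\|\le 1,\ \|v\|\le\tau\}$. For $1<p\le 2$, $B$ is $p$-uniformly smooth if $\lim_{\tau\to0}\rho_B(\tau)/\tau=0$ and there is a constant $K$ with $\rho_B(\tau)\le K\tau^p$ for all $\tau>0$. A (Banach) representation of a locally compact group $G$ on $B$ is a group homomorphism $\pi:G\to\mathrm{GL}(B)$ (invertible continuous linear maps) that is continuous for the strong operator topology; it is uniformly bounded if $\sup_{g\in G}\|\pi(g)\|_{op}<\infty$. A cocycle with coefficients in $(\pi,B)$ is a continuous map $b:G\to B$ with $b(gh)=b(g)+\pi(g)b(h)$ for all $g,h\in G$. (For discrete $\Gamma$ the continuity conditions are automatic.) $|g|_S$ is the word length of $g$ with respect to $S$, i.e. the least $n$ such that $g$ is a product of $n$ elements of $S\cup S^{-1}$ (with $|e|_S=0$). *)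

theory Defs
  imports "HOL-Analysis.Analysis" "HOL-Algebra.Generated_Groups"
begin

text \<open>Banach spaces are types of class \<open>banach\<close>, hence real; a complex Banach space is covered
  through its underlying real space, which has the same modulus of smoothness.\<close>

definition smoothness_modulus :: "'b::banach itself \<Rightarrow> real \<Rightarrow> real" where
  "smoothness_modulus _ \<tau> =
     Sup {(norm (u + v) + norm (u - v)) / 2 - 1 | u v :: 'b. norm u \<le> 1 \<and> norm v \<le> \<tau>}"

definition p_uniformly_smooth :: "real \<Rightarrow> 'b::banach itself \<Rightarrow> bool" where
  "p_uniformly_smooth p B \<longleftrightarrow>
     ((\<lambda>\<tau>. smoothness_modulus B \<tau> / \<tau>) \<longlongrightarrow> 0) (at_right 0) \<and>
     (\<exists>K. \<forall>\<tau>>0. smoothness_modulus B \<tau> \<le> K * \<tau> powr p)"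

text \<open>The invertible elements of the monoid of continuous linear maps, so inverses are again
  continuous.\<close>

definition GL :: "'b::banach itself \<Rightarrow> ('b \<Rightarrow>\<^sub>L 'b) monoid" where
  "GL _ = units_of \<lparr>carrier = UNIV, monoid.mult = (o\<^sub>L), one = id_blinfun\<rparr>"

text \<open>Groups carry the discrete topology, so representations and cocycles have no continuity
  condition in the group variable.\<close>

definition representation :: "('g, 'm) monoid_scheme \<Rightarrow> ('g \<Rightarrow> 'b::banach \<Rightarrow>\<^sub>L 'b) \<Rightarrow> bool" where
  "representation G \<pi> \<longleftrightarrow> \<pi> \<in> hom G (GL TYPE('b))"

definition uniformly_bounded :: "('g, 'm) monoid_scheme \<Rightarrow> ('g \<Rightarrow> 'b::banach \<Rightarrow>\<^sub>L 'b) \<Rightarrow> bool" where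
  "uniformly_bounded G \<pi> \<longleftrightarrow> bdd_above ((\<lambda>g. norm (\<pi> g)) ` carrier G)"

definition cocycle ::
  "('g, 'm) monoid_scheme \<Rightarrow> ('g \<Rightarrow> 'b::banach \<Rightarrow>\<^sub>L 'b) \<Rightarrow> ('g \<Rightarrow> 'b) \<Rightarrow> bool" where
  "cocycle G \<pi> b \<longleftrightarrow>
     (\<forall>g\<in>carrier G. \<forall>h\<in>carrier G. b (g \<otimes>\<^bsub>G\<^esub> h) = b g + blinfun_apply (\<pi> g) (b h))"

definition finite_generating_set :: "('g, 'm) monoid_scheme \<Rightarrow> 'g set \<Rightarrow> bool" where
  "finite_generating_set G S \<longleftrightarrow> finite S \<and> S \<subseteq> carrier G \<and> generate G S = carrier G"

definition word_length :: "('g, 'm) monoid_scheme \<Rightarrow> 'g set \<Rightarrow> 'g \<Rightarrow> nat" where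
  "word_length G S g =
     (LEAST n. \<exists>ws. length ws = n \<and> set ws \<subseteq> S \<union> m_inv G ` S \<and>
                    foldr (\<lambda>x y. x \<otimes>\<^bsub>G\<^esub> y) ws \<one>\<^bsub>G\<^esub> = g)"

definition ell_infty :: "('g, 'm) monoid_scheme \<Rightarrow> ('g \<Rightarrow> real) set" where
  "ell_infty G = {f. bounded (f ` carrier G)}"

text \<open>Elements of \<open>ell_infty G\<close> are not identified when they agree on \<open>carrier G\<close>, but linearity
  and positivity force a mean to depend only on the values on \<open>carrier G\<close>.\<close>

definition left_invariant_mean ::
  "('g, 'm) monoid_scheme \<Rightarrow> (('g \<Rightarrow> real) \<Rightarrow> real) \<Rightarrow> bool" where
  "left_invariant_mean G M \<longleftrightarrow>
     (\<forall>f\<in>ell_infty G. \<forall>h\<in>ell_infty G. M (\<lambda>x. f x + h x) = M f + M h) \<and>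
     (\<forall>c. \<forall>f\<in>ell_infty G. M (\<lambda>x. c * f x) = c * M f) \<and>
     (\<forall>f\<in>ell_infty G. (\<forall>x\<in>carrier G. 0 \<le> f x) \<longrightarrow> 0 \<le> M f) \<and>
     M (\<lambda>_. 1) = 1 \<and>
     (\<forall>g\<in>carrier G. \<forall>f\<in>ell_infty G. M (\<lambda>x. f (inv\<^bsub>G\<^esub> g \<otimes>\<^bsub>G\<^esub> x)) = M f)"

definition amenable :: "('g, 'm) monoid_scheme \<Rightarrow> bool" where
  "amenable G \<longleftrightarrow> (\<exists>M. left_invariant_mean G M)"

end

theory Submission
  imports Defs
begin

text \<open>Let \<open>W\<close> be the random walk on \<open>\<Gamma>\<close> whose steps are uniform on the symmetric set
\<open>T = {\<one>} \<union> S \<union> S\<inverse>\<close>. Three facts about it are combined.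

Smoothness makes \<open>b(W)\<close> diffusive: the \<open>p\<close>-th moment of \<open>norm b(W)\<close> after \<open>n\<close> steps is
\<open>O(n)\<close> (\<open>cocycle_growth\<close>). A \<open>p\<close>-uniformly smooth space has martingale type \<open>p\<close>
(\<open>p_uniformly_smooth_centred_sum\<close>), and \<open>b(W)\<close> minus its predictable compensator is a
martingale whose increments are bounded because \<open>\<pi>\<close> is uniformly bounded. The compensator is a sum of \<open>n\<close> vectors \<open>\<pi>(W) v\<close>, where \<open>v\<close> is the
mean of \<open>b\<close> over \<open>T\<close>, and could be of size \<open>n\<close>; but the time-reversed walk has the
same law, and in the difference of the forward and the backward martingale the two compensators
telescope (\<open>forward_backward\<close>).

Since \<open>norm b(g)\<close> dominates every multiple of the \<open>p\<close>-th root of the word length, up to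
finitely many \<open>g\<close>, the expected word length of \<open>W\<close> is then \<open>o(n)\<close>.

A walk of zero speed forces amenability. Let \<open>D n\<close> be the sum over \<open>g\<close> of \<open>N(g)\<^sup>2\<close>, where
\<open>N(g)\<close> is the number of words of length \<open>n\<close> that multiply to \<open>g\<close>, and let \<open>q\<close> be the
cardinality of \<open>T\<close>. Half of the \<open>q ^ n\<close> words end in a ball with subexponentially many elements, so
the Cauchy-Schwarz inequality shows that \<open>D n / q ^ (2 * n)\<close> does not decay exponentially, and some
quotient \<open>D (n + 1) / (q\<^sup>2 * D n)\<close> is as close to \<open>1\<close> as desired (\<open>ratio_if_slow\<close>). Then
\<open>N\<close> is almost invariant in \<open>l\<^sup>2\<close>, the probability measure \<open>N\<^sup>2 / D n\<close> is almost
invariant in \<open>l\<^sup>1\<close> (\<open>almost_invariant_measures_if_ratio\<close>), and a cluster point of such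
measures is an invariant mean (\<open>amenable_if_almost_invariant_measures\<close>).\<close>

section \<open>Uniform smoothness and centred sums\<close>

lemma weighted_am_gm:
  fixes a b r :: real
  assumes "0 \<le> a" "0 < b" "0 \<le> r" "r \<le> 1"
  shows "a powr r * b powr (1 - r) \<le> r * a + (1 - r) * b"
  using Youngs_inequality_0[of r "1 - r" a b] assms by (cases "a = 0") auto

text \<open>The function \<open>t powr r\<close> with \<open>0 < r \<le> 1\<close> is concave, hence below its tangent lines.\<close>

lemma powr_le_tangent:
  fixes a b r :: real
  assumes "0 \<le> a" "0 < b" "0 < r" "r \<le> 1"
  shows "a powr r \<le> b powr r + r * b powr (r - 1) * (a - b)"
proof -
  have "a powr r * b powr (1 - r) \<le> r * a + (1 - r) * b"
    using weighted_am_gm assms by simp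
  hence "(a powr r * b powr (1 - r)) * b powr (r - 1) \<le> (r * a + (1 - r) * b) * b powr (r - 1)"
    by (intro mult_right_mono) auto
  moreover have "b powr (1 - r) * b powr (r - 1) = 1"
    using assms by (simp flip: powr_add)
  moreover have "b * b powr (r - 1) = b powr r"
    using assms by (simp add: powr_mult_base)
  moreover from this have "b * (r * b powr (r - 1)) = r * b powr r"
    by (metis mult.left_commute)
  ultimately show ?thesis by (simp add: algebra_simps)
qed

text \<open>The function \<open>t powr p\<close> with \<open>1 \<le> p\<close> is convex, hence above its tangent lines.\<close>

lemma powr_ge_tangent:
  fixes t s p :: real
  assumes "0 \<le> t" "0 \<le> s" "1 \<le> p"
  shows "s powr p + p * s powr (p - 1) * (t - s) \<le> t powr p"
proof (cases "s = 0")
  case True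
  then show ?thesis by simp
next
  case False
  with assms have s: "s > 0" by simp
  have "(t powr p) powr (1/p) * (s powr p) powr (1 - 1/p) \<le> (1/p) * t powr p + (1 - 1/p) * s powr p"
    using weighted_am_gm[of "t powr p" "s powr p" "1/p"] assms s by simp
  also have "(t powr p) powr (1/p) * (s powr p) powr (1 - 1/p) = t * s powr (p - 1)"
    using assms by (simp add: powr_powr right_diff_distrib)
  finally have "p * (t * s powr (p - 1)) \<le> p * ((1/p) * t powr p + (1 - 1/p) * s powr p)"
    using assms by (intro mult_left_mono) auto
  also have "\<dots> = t powr p + (p - 1) * s powr p"
    using assms by (simp add: field_simps)
  finally have 1: "p * (t * s powr (p - 1)) \<le> t powr p + (p - 1) * s powr p" .
  have "s * s powr (p - 1) = s powr p" using s by (simp add: powr_mult_base)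
  with 1 show ?thesis by (simp add: algebra_simps)
qed

text \<open>With \<open>m = (a + b) / 2\<close> and \<open>d = \<bar>a - b\<bar> / 2\<close> the mean of \<open>a\<^sup>2\<close> and \<open>b\<^sup>2\<close> is
\<open>m\<^sup>2 + d\<^sup>2\<close>. Concavity of \<open>t powr (p / 2)\<close> turns this identity, the exponent-\<open>2\<close> case, into
the inequality for exponents below \<open>2\<close>.\<close>

lemma mean_powr_le:
  fixes a b p :: real
  assumes "0 \<le> a" "0 \<le> b" "1 < p" "p \<le> 2"
  shows "(a powr p + b powr p) / 2 \<le> ((a + b) / 2) powr p + \<bar>(a - b) / 2\<bar> powr p"
proof (cases "a + b = 0")
  case True
  with assms have "a = 0" "b = 0" by auto
  then show ?thesis by simp
next
  case False
  define m d where "m = (a + b) / 2" and "d = \<bar>(a - b) / 2\<bar>"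
  have m: "m > 0" "d \<ge> 0" "d \<le> m" using False assms by (auto simp: m_def d_def)
  \<comment> \<open>The tangent of \<open>t powr (p / 2)\<close> at \<open>m\<^sup>2\<close>, evaluated at \<open>x\<^sup>2\<close>.\<close>
  have tangent: "x powr p \<le> m powr p + p / 2 * m powr (p - 2) * (x\<^sup>2 - m\<^sup>2)" if "x \<ge> 0" for x
  proof -
    have sq: "(y\<^sup>2) powr q = y powr (2 * q)" if "y \<ge> 0" for y q :: real
      using powr_powr[of y 2 q] that by simp
    have "(x\<^sup>2) powr (p/2) \<le> (m\<^sup>2) powr (p/2) + p / 2 * (m\<^sup>2) powr (p/2 - 1) * (x\<^sup>2 - m\<^sup>2)"
      using powr_le_tangent[of "x\<^sup>2" "m\<^sup>2" "p/2"] assms m by simp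
    moreover have "(x\<^sup>2) powr (p/2) = x powr p"
      using that by (simp add: sq)
    moreover have "(m\<^sup>2) powr (p/2) = m powr p" "(m\<^sup>2) powr (p/2 - 1) = m powr (p - 2)"
      using m by (simp_all add: sq right_diff_distrib)
    ultimately show ?thesis by simp
  qed
  have "a powr p + b powr p \<le> 2 * m powr p + p / 2 * m powr (p - 2) * (a\<^sup>2 - m\<^sup>2 + (b\<^sup>2 - m\<^sup>2))"
    unfolding distrib_left using tangent[of a] tangent[of b] assms by linarith
  also have "a\<^sup>2 - m\<^sup>2 + (b\<^sup>2 - m\<^sup>2) = 2 * d\<^sup>2"
    by (simp add: m_def d_def power2_eq_square field_simps)
  also have "p / 2 * m powr (p - 2) * (2 * d\<^sup>2) = 2 * (p / 2 * m powr (p - 2) * d\<^sup>2)"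
    by simp
  also have "p / 2 * m powr (p - 2) * d\<^sup>2 \<le> d powr p"
  proof (cases "d = 0")
    case False
    have "p / 2 * m powr (p - 2) * d\<^sup>2 \<le> 1 * d powr (p - 2) * d\<^sup>2"
      using m assms False by (intro mult_right_mono mult_mono powr_mono2') auto
    also have "\<dots> = d powr (p - 2) * d powr 2" using m by simp
    also have "\<dots> = d powr p" by (simp flip: powr_add)
    finally show ?thesis .
  qed simp
  finally have "a powr p + b powr p \<le> 2 * (m powr p + d powr p)" by simp
  thus ?thesis by (simp add: m_def d_def)
qed

text \<open>The supremum in the modulus is over a bounded set, so it bounds each of its members.\<close>

lemma norm_mean_le_smoothness_modulus:
  fixes u v :: "'b::banach"
  assumes "norm u \<le> 1" "norm v \<le> \<tau>"
  shows "(norm (u + v) + norm (u - v)) / 2 - 1 \<le> smoothness_modulus TYPE('b) \<tau>"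
  unfolding smoothness_modulus_def
proof (rule cSup_upper)
  show "bdd_above {(norm (u + v) + norm (u - v)) / 2 - 1 |u v :: 'b. norm u \<le> 1 \<and> norm v \<le> \<tau>}"
  proof (rule bdd_aboveI[of _ \<tau>], clarify)
    fix u v :: 'b assume "norm u \<le> 1" "norm v \<le> \<tau>"
    then have "norm (u + v) \<le> 1 + \<tau>" "norm (u - v) \<le> 1 + \<tau>"
      using norm_triangle_ineq[of u v] norm_triangle_ineq4[of u v] by linarith+
    then show "(norm (u + v) + norm (u - v)) / 2 - 1 \<le> \<tau>" by (simp add: field_simps)
  qed
qed (use assms in blast)

text \<open>The modulus controls only the arithmetic mean of \<open>norm (x + y)\<close> and \<open>norm (x - y)\<close>; \<open>mean_powr_le\<close>
upgrades this to \<open>p\<close>-th powers, since the two norms differ by at most \<open>2 * norm y\<close>. Everything is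
first done for \<open>norm x = 1\<close>, and large \<open>y\<close> are dealt with by the triangle inequality alone.\<close>

lemma p_uniformly_smooth_two_point:
  assumes "p_uniformly_smooth p TYPE('b::banach)" "1 < p" "p \<le> 2"
  obtains C where "C \<ge> 0"
    "\<And>x y :: 'b. (norm (x + y) powr p + norm (x - y) powr p) / 2 \<le> norm x powr p + C * norm y powr p"
proof -
  obtain K0 where K0: "\<And>\<tau>. \<tau> > 0 \<Longrightarrow> smoothness_modulus TYPE('b) \<tau> \<le> K0 * \<tau> powr p"
    using assms unfolding p_uniformly_smooth_def by blast
  define K where "K = \<bar>K0\<bar>"
  define C where "C = 2 * K + K\<^sup>2 + 2 powr p"
  have K: "K \<ge> 0" by (simp add: K_def)
  have C: "C \<ge> 0" "2 powr p \<le> C" "1 \<le> C"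
    using K ge_one_powr_ge_zero[of 2 p] assms zero_le_power2[of K] unfolding C_def by linarith+
  have unit: "(norm (u + v) powr p + norm (u - v) powr p) / 2 \<le> 1 + C * norm v powr p"
    if u: "norm u = 1" for u v :: 'b
  proof -
    define \<tau> where "\<tau> = norm v"
    have tri: "norm (u + v) \<le> 1 + \<tau>" "norm (u - v) \<le> 1 + \<tau>"
      using norm_triangle_ineq[of u v] norm_triangle_ineq4[of u v] u by (simp_all add: \<tau>_def)
    consider "\<tau> = 0" | "0 < \<tau>" "\<tau> \<le> 1" | "1 < \<tau>" unfolding \<tau>_def by fastforce
    then show ?thesis
    proof cases
      case 1
      then show ?thesis using u by (simp add: \<tau>_def)
    next
      case 3
      have "norm (u + v) powr p \<le> (2 * \<tau>) powr p" "norm (u - v) powr p \<le> (2 * \<tau>) powr p"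
        using tri 3 assms by (auto intro!: powr_mono2)
      hence "(norm (u + v) powr p + norm (u - v) powr p) / 2 \<le> 2 powr p * \<tau> powr p"
        using 3 by (simp add: powr_mult)
      also have "\<dots> \<le> C * \<tau> powr p" using C by (intro mult_right_mono) auto
      finally show ?thesis by (simp add: \<tau>_def)
    next
      case 2
      define m where "m = (norm (u + v) + norm (u - v)) / 2"
      have "2 * norm u = norm ((u + v) + (u - v))" by (simp flip: scaleR_2)
      also have "\<dots> \<le> norm (u + v) + norm (u - v)" by (rule norm_triangle_ineq)
      finally have m1: "1 \<le> m" using u by (simp add: m_def)
      have "m - 1 \<le> K0 * \<tau> powr p"
        using norm_mean_le_smoothness_modulus[of u v \<tau>] K0[of \<tau>] 2 u by (simp add: m_def \<tau>_def)
      also have "\<dots> \<le> K * \<tau> powr p" by (simp add: K_def mult_right_mono)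
      finally have m2: "m \<le> 1 + K * \<tau> powr p" by simp
      have \<tau>p: "0 \<le> \<tau> powr p" "\<tau> powr p \<le> 1" using 2 assms by (auto intro!: powr_le1)
      have "m powr p \<le> m powr 2" using m1 assms by (intro powr_mono) auto
      also have "\<dots> = m\<^sup>2" using m1 by simp
      also have "\<dots> \<le> (1 + K * \<tau> powr p)\<^sup>2" using m1 m2 by (intro power_mono) auto
      also have "\<dots> = 1 + 2 * K * \<tau> powr p + K\<^sup>2 * (\<tau> powr p * \<tau> powr p)"
        by (simp add: power2_eq_square algebra_simps)
      also have "\<dots> \<le> 1 + 2 * K * \<tau> powr p + K\<^sup>2 * (\<tau> powr p * 1)"
        using \<tau>p by (intro add_left_mono mult_left_mono) auto
      finally have mp: "m powr p \<le> 1 + (2 * K + K\<^sup>2) * \<tau> powr p" by (simp add: algebra_simps)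
      have "\<bar>norm (u + v) - norm (u - v)\<bar> \<le> norm ((u + v) - (u - v))"
        by (rule norm_triangle_ineq3)
      also have "\<dots> = 2 * \<tau>" by (simp add: \<tau>_def flip: scaleR_2)
      finally have "\<bar>(norm (u + v) - norm (u - v)) / 2\<bar> powr p \<le> \<tau> powr p"
        using assms by (intro powr_mono2) auto
      also have "\<dots> \<le> 2 powr p * \<tau> powr p"
        using ge_one_powr_ge_zero[of 2 p] assms \<tau>p by (simp add: mult_le_cancel_right1)
      finally have d: "\<bar>(norm (u + v) - norm (u - v)) / 2\<bar> powr p \<le> 2 powr p * \<tau> powr p" .
      have "(norm (u + v) powr p + norm (u - v) powr p) / 2
              \<le> m powr p + \<bar>(norm (u + v) - norm (u - v)) / 2\<bar> powr p"
        unfolding m_def using assms by (intro mean_powr_le) auto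
      also have "\<dots> \<le> 1 + C * \<tau> powr p" using mp d by (simp add: C_def algebra_simps)
      finally show ?thesis by (simp add: \<tau>_def)
    qed
  qed
  show ?thesis
  proof (rule that[OF C(1)])
    fix x y :: 'b
    show "(norm (x + y) powr p + norm (x - y) powr p) / 2 \<le> norm x powr p + C * norm y powr p"
    proof (cases "x = 0")
      case True
      then show ?thesis using C by (simp add: mult_le_cancel_right1)
    next
      case False
      define r where "r = norm x"
      have r: "r > 0" using False by (simp add: r_def)
      have scale: "norm (z /\<^sub>R r) powr p = norm z powr p / r powr p" for z :: 'b
      proof -
        have "norm (z /\<^sub>R r) = norm z / r" using r by (simp add: divide_inverse mult.commute)
        thus ?thesis using r by (simp add: powr_divide)
      qed
      have "(norm (x /\<^sub>R r + y /\<^sub>R r) powr p + norm (x /\<^sub>R r - y /\<^sub>R r) powr p) / 2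
              \<le> 1 + C * norm (y /\<^sub>R r) powr p"
        by (rule unit) (use r in \<open>simp add: r_def\<close>)
      hence "(norm (x + y) powr p / r powr p + norm (x - y) powr p / r powr p) / 2
              \<le> 1 + C * (norm y powr p / r powr p)"
        unfolding scaleR_add_right[symmetric] scaleR_diff_right[symmetric] scale .
      moreover have "(a + b) / 2 \<le> R + C * c" if "(a / R + b / R) / 2 \<le> 1 + C * (c / R)" "R > 0"
        for a b c R :: real
      proof -
        have "(a + b) / 2 = R * ((a / R + b / R) / 2)" using that by (simp add: field_simps)
        also have "\<dots> \<le> R * (1 + C * (c / R))" using that by (intro mult_left_mono) auto
        also have "\<dots> = R + C * c" using that by (simp add: field_simps)
        finally show ?thesis .
      qed
      ultimately show ?thesis using r unfolding r_def by simp
    qed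
  qed
qed

text \<open>One step of a martingale, in unnormalised form. The two-point inequality bounds
\<open>norm (x + y) powr p\<close> at the price of \<open>- norm (x - y) powr p\<close>, and by Jensen's inequality the
average of the latter over a centred \<open>y\<close> is at most \<open>- norm x powr p\<close>.\<close>

lemma p_uniformly_smooth_centred_sum:
  assumes "p_uniformly_smooth p TYPE('b::banach)" "1 < p" "p \<le> 2"
  obtains C where "C \<ge> 0"
    "\<And>(I :: 'i set) x (y :: 'i \<Rightarrow> 'b). finite I \<Longrightarrow> (\<Sum>i\<in>I. y i) = 0 \<Longrightarrow>
       (\<Sum>i\<in>I. norm (x + y i) powr p) \<le> card I * norm x powr p + C * (\<Sum>i\<in>I. norm (y i) powr p)"
proof -
  obtain C where C: "C \<ge> 0"
    "\<And>x y :: 'b. (norm (x + y) powr p + norm (x - y) powr p) / 2 \<le> norm x powr p + C * norm y powr p"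
    using p_uniformly_smooth_two_point[OF assms] by blast
  show ?thesis
  proof (rule that[of "2 * C"])
    fix I :: "'i set" and x and y :: "'i \<Rightarrow> 'b"
    assume I: "finite I" "(\<Sum>i\<in>I. y i) = 0"
    have "card I * norm x = norm (\<Sum>i\<in>I. x - y i)"
      using I by (simp add: sum_subtractf sum_constant_scaleR)
    also have "\<dots> \<le> (\<Sum>i\<in>I. norm (x - y i))" by (rule norm_sum)
    finally have "0 \<le> (\<Sum>i\<in>I. norm (x - y i) - norm x)" by (simp add: sum_subtractf)
    hence "0 \<le> p * norm x powr (p - 1) * (\<Sum>i\<in>I. norm (x - y i) - norm x)"
      using assms by (intro mult_nonneg_nonneg) auto
    also have "\<dots> = (\<Sum>i\<in>I. p * norm x powr (p - 1) * (norm (x - y i) - norm x))"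
      by (rule sum_distrib_left)
    also have "\<dots> \<le> (\<Sum>i\<in>I. norm (x - y i) powr p - norm x powr p)"
    proof (rule sum_mono)
      fix i
      show "p * norm x powr (p - 1) * (norm (x - y i) - norm x) \<le> norm (x - y i) powr p - norm x powr p"
        using powr_ge_tangent[of "norm (x - y i)" "norm x" p] assms by simp
    qed
    finally have jensen: "card I * norm x powr p \<le> (\<Sum>i\<in>I. norm (x - y i) powr p)"
      by (simp add: sum_subtractf)
    have "(\<Sum>i\<in>I. norm (x + y i) powr p)
            \<le> (\<Sum>i\<in>I. 2 * norm x powr p + 2 * C * norm (y i) powr p - norm (x - y i) powr p)"
    proof (rule sum_mono)
      fix i
      show "norm (x + y i) powr p \<le> 2 * norm x powr p + 2 * C * norm (y i) powr p - norm (x - y i) powr p"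
        using C(2)[of x "y i"] by simp
    qed
    also have "\<dots> = 2 * card I * norm x powr p + 2 * C * (\<Sum>i\<in>I. norm (y i) powr p)
                      - (\<Sum>i\<in>I. norm (x - y i) powr p)"
      by (simp add: sum_subtractf sum.distrib sum_distrib_left)
    finally show "(\<Sum>i\<in>I. norm (x + y i) powr p)
            \<le> card I * norm x powr p + 2 * C * (\<Sum>i\<in>I. norm (y i) powr p)"
      using jensen by simp
  qed (use C in simp)
qed

section \<open>Words as a random walk\<close>

text \<open>The law of the walk after \<open>n\<close> steps is the uniform distribution on words of length \<open>n\<close> over
\<open>T\<close>. Expectations are kept as plain sums over words and thus carry a factor \<open>card T ^ n\<close>.
The neutral element is in \<open>T\<close> so that shorter words can be padded, and symmetry of \<open>T\<close> makes
reversal of words a bijection.\<close>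

locale symmetric_walk = group G for G :: "('g, 'm) monoid_scheme" (structure) +
  fixes T :: "'g set"
  assumes finite_T: "finite T"
    and T_carrier: "T \<subseteq> carrier G"
    and one_T: "\<one> \<in> T"
    and inv_T: "s \<in> T \<Longrightarrow> inv s \<in> T"
begin

definition words :: "nat \<Rightarrow> 'g list set" where
  "words n = {w. set w \<subseteq> T \<and> length w = n}"

definition endpoint :: "'g list \<Rightarrow> 'g" where
  "endpoint w = foldr (\<otimes>) w \<one>"

text \<open>The word for the inverse element: the walk run backwards from its endpoint.\<close>

definition reversed :: "'g list \<Rightarrow> 'g list" where
  "reversed w = rev (map (m_inv G) w)"

text \<open>The \<open>n\<close>-fold convolution power of the indicator function of \<open>T\<close>.\<close>

definition visits :: "nat \<Rightarrow> 'g \<Rightarrow> real" where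
  "visits n g = card {w \<in> words n. endpoint w = g}"

definition reach :: "nat \<Rightarrow> 'g set" where
  "reach n = endpoint ` words n"

lemma finite_words [simp]: "finite (words n)"
  using finite_lists_length_eq[OF finite_T] by (simp add: words_def)

lemma card_words: "card (words n) = card T ^ n"
  using card_lists_length_eq[OF finite_T] by (simp add: words_def)

lemma card_T_pos: "card T > 0"
  using finite_T one_T by (auto simp: card_gt_0_iff)

lemma words_carrier: "w \<in> words n \<Longrightarrow> set w \<subseteq> carrier G"
  using T_carrier by (auto simp: words_def)

lemma endpoint_Nil [simp]: "endpoint [] = \<one>"
  and endpoint_Cons [simp]: "endpoint (s # w) = s \<otimes> endpoint w"
  by (simp_all add: endpoint_def)

lemma endpoint_closed [simp]: "set w \<subseteq> carrier G \<Longrightarrow> endpoint w \<in> carrier G"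
  by (induction w) auto

lemma endpoint_append:
  "set u \<subseteq> carrier G \<Longrightarrow> set w \<subseteq> carrier G \<Longrightarrow> endpoint (u @ w) = endpoint u \<otimes> endpoint w"
  by (induction u) (auto simp: m_assoc)

lemma reversed_Cons: "reversed (s # w) = reversed w @ [inv s]"
  by (simp add: reversed_def)

lemma set_reversed: "set w \<subseteq> carrier G \<Longrightarrow> set (reversed w) \<subseteq> carrier G"
  by (auto simp: reversed_def)

lemma endpoint_reversed: "set w \<subseteq> carrier G \<Longrightarrow> endpoint (reversed w) = inv (endpoint w)"
proof (induction w)
  case (Cons s w)
  then show ?case
    using set_reversed[of w] by (simp add: reversed_Cons endpoint_append inv_mult_group)
qed (simp add: reversed_def)

lemma reversed_words: "w \<in> words n \<Longrightarrow> reversed w \<in> words n"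
  using inv_T by (auto simp: words_def reversed_def)

lemma reversed_reversed: "set w \<subseteq> carrier G \<Longrightarrow> reversed (reversed w) = w"
  by (induction w) (auto simp: reversed_def)

lemma bij_reversed: "bij_betw reversed (words n) (words n)"
  by (rule bij_betw_byWitness[where f' = reversed])
     (auto simp: reversed_words reversed_reversed words_carrier)

lemma bij_append_words: "bij_betw (\<lambda>(u, w). u @ w) (words m \<times> words n) (words (m + n))"
proof (rule bij_betw_byWitness[where f' = "\<lambda>w. (take m w, drop m w)"])
  show "(\<lambda>w. (take m w, drop m w)) ` words (m + n) \<subseteq> words m \<times> words n"
    by (auto simp: words_def dest: in_set_takeD in_set_dropD)
qed (auto simp: words_def)

lemma sum_words_append:
  "(\<Sum>w\<in>words (m + n). f w) = (\<Sum>u\<in>words m. \<Sum>w\<in>words n. f (u @ w))"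
  using sum.reindex_bij_betw[OF bij_append_words, of f m n]
  by (simp add: sum.cartesian_product split_def)

lemma sum_words_one: "(\<Sum>w\<in>words 1. f w) = (\<Sum>s\<in>T. f [s])"
proof -
  have "words 1 = (\<lambda>s. [s]) ` T" by (auto simp: words_def length_Suc_conv)
  thus ?thesis by (simp add: sum.reindex inj_on_def)
qed

lemma sum_words_Suc: "(\<Sum>w\<in>words (Suc n). f w) = (\<Sum>w\<in>words n. \<Sum>s\<in>T. f (w @ [s]))"
  using sum_words_append[of f n 1] unfolding sum_words_one by simp

lemma sum_words_reversed: "(\<Sum>w\<in>words n. f (reversed w)) = (\<Sum>w\<in>words n. f w)"
  by (rule sum.reindex_bij_betw[OF bij_reversed])

lemma finite_reach [simp]: "finite (reach n)"
  by (simp add: reach_def)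

lemma reach_carrier: "reach n \<subseteq> carrier G"
  using words_carrier by (auto simp: reach_def)

lemma reach_mult:
  assumes "g \<in> reach m" "h \<in> reach n"
  shows "g \<otimes> h \<in> reach (m + n)"
proof -
  obtain u w where "u \<in> words m" "g = endpoint u" "w \<in> words n" "h = endpoint w"
    using assms by (auto simp: reach_def)
  moreover from this have "u @ w \<in> words (m + n)" by (simp add: words_def)
  ultimately show ?thesis
    unfolding reach_def using words_carrier by (metis endpoint_append imageI)
qed

lemma T_reach: "T \<subseteq> reach 1"
proof
  fix s assume s: "s \<in> T"
  hence "[s] \<in> words 1" by (simp add: words_def)
  moreover have "endpoint [s] = s" using s T_carrier by auto
  ultimately show "s \<in> reach 1" unfolding reach_def by (metis image_eqI)
qed

lemma one_reach: "\<one> \<in> reach n"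
proof (induction n)
  case 0
  have "words 0 = {[]}" by (auto simp: words_def)
  then show ?case by (simp add: reach_def)
next
  case (Suc n)
  have "\<one> \<in> reach 1" using one_T T_reach by blast
  from reach_mult[OF this Suc] show ?case by simp
qed

lemma reach_mono:
  assumes "m \<le> n"
  shows "reach m \<subseteq> reach n"
proof
  fix g assume g: "g \<in> reach m"
  have "g \<otimes> \<one> \<in> reach (m + (n - m))" by (rule reach_mult[OF g one_reach])
  moreover have "g \<in> carrier G" using g reach_carrier by blast
  ultimately show "g \<in> reach n" using assms by simp
qed

lemma card_reach: "card (reach n) \<le> card T ^ n"
  using card_image_le[of "words n" endpoint] by (simp add: reach_def card_words)

lemma visits_nonneg [simp]: "visits n g \<ge> 0"
  by (simp add: visits_def)

lemma visits_eq_0: "g \<notin> reach n \<Longrightarrow> visits n g = 0"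
  by (auto simp: visits_def reach_def)

text \<open>A sum over words that only depends on the endpoint is a sum over group elements weighted by \<open>visits\<close>.\<close>

lemma sum_visits:
  assumes "finite X" "reach n \<subseteq> X"
  shows "(\<Sum>g\<in>X. visits n g * f g) = (\<Sum>w\<in>words n. f (endpoint w))"
proof -
  have "(\<Sum>w\<in>words n. f (endpoint w)) = (\<Sum>g\<in>X. \<Sum>w\<in>{w\<in>words n. endpoint w = g}. f (endpoint w))"
    using assms by (subst sum.group) (auto simp: reach_def)
  also have "\<dots> = (\<Sum>g\<in>X. visits n g * f g)"
    by (intro sum.cong refl) (simp add: visits_def)
  finally show ?thesis by simp
qed

lemma visits_inv: "g \<in> carrier G \<Longrightarrow> visits n (inv g) = visits n g"
proof -
  assume g: "g \<in> carrier G"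
  have 1: "endpoint (reversed w) = inv (endpoint w)" if "w \<in> words n" for w
    using endpoint_reversed[OF words_carrier[OF that]] .
  have "bij_betw reversed {w \<in> words n. endpoint w = inv g} {w \<in> words n. endpoint w = g}"
  proof (rule bij_betw_byWitness[where f' = reversed])
    show "reversed ` {w \<in> words n. endpoint w = inv g} \<subseteq> {w \<in> words n. endpoint w = g}"
      using g 1 reversed_words by auto
    show "reversed ` {w \<in> words n. endpoint w = g} \<subseteq> {w \<in> words n. endpoint w = inv g}"
      using g 1 reversed_words by auto
  qed (auto simp: reversed_reversed words_carrier)
  thus ?thesis by (simp add: visits_def bij_betw_same_card)
qed

lemma visits_append:
  assumes "g \<in> carrier G"
  shows "visits (m + n) g = (\<Sum>u\<in>words m. visits n (inv (endpoint u) \<otimes> g))"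
proof -
  have card_sum: "real (card {w \<in> A. P w}) = (\<Sum>w\<in>A. if P w then 1 else 0)" if "finite A"
    for A :: "'g list set" and P
  proof -
    have "real (card {w \<in> A. P w}) = (\<Sum>w\<in>{w \<in> A. P w}. 1)" by simp
    also have "\<dots> = (\<Sum>w\<in>A. if P w then 1 else 0)" using that by (rule sum.inter_filter)
    finally show ?thesis .
  qed
  have "visits (m + n) g = (\<Sum>u\<in>words m. \<Sum>w\<in>words n. if endpoint (u @ w) = g then 1 else 0)"
    unfolding visits_def card_sum[OF finite_words] by (rule sum_words_append)
  also have "\<dots> = (\<Sum>u\<in>words m. visits n (inv (endpoint u) \<otimes> g))"
  proof (intro sum.cong refl)
    fix u assume u: "u \<in> words m"
    have eq: "(endpoint (u @ w) = g) = (endpoint w = inv (endpoint u) \<otimes> g)" if w: "w \<in> words n" for w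
      using words_carrier[OF u] words_carrier[OF w] assms inv_solve_left[of "endpoint w" "endpoint u" g]
      by (auto simp: endpoint_append)
    show "(\<Sum>w\<in>words n. if endpoint (u @ w) = g then 1 else 0) = visits n (inv (endpoint u) \<otimes> g)"
      unfolding visits_def card_sum[OF finite_words] by (rule sum.cong) (simp_all only: eq)
  qed
  finally show ?thesis .
qed

text \<open>Convolution by the symmetric set \<open>T\<close> is self-adjoint, so the inner product of its \<open>m\<close>-th and
\<open>n\<close>-th powers depends only on \<open>m + n\<close>: it counts closed words of that length.\<close>

lemma sum_visits_mult:
  assumes "finite X" "reach m \<subseteq> X"
  shows "(\<Sum>g\<in>X. visits m g * visits n g) = visits (m + n) \<one>"
proof -
  have "visits (m + n) \<one> = (\<Sum>u\<in>words m. visits n (endpoint u))"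
    unfolding visits_append[OF one_closed]
    by (intro sum.cong refl) (simp add: visits_inv words_carrier)
  thus ?thesis by (simp add: sum_visits[OF assms])
qed

end

section \<open>Moments of a cocycle along the random walk\<close>

lemma
  fixes \<pi> :: "'g \<Rightarrow> 'b::banach \<Rightarrow>\<^sub>L 'b"
  assumes "group G" "representation G \<pi>"
  shows representation_one: "\<pi> \<one>\<^bsub>G\<^esub> = id_blinfun"
    and representation_mult: "g \<in> carrier G \<Longrightarrow> h \<in> carrier G \<Longrightarrow> \<pi> (g \<otimes>\<^bsub>G\<^esub> h) = \<pi> g o\<^sub>L \<pi> h"
proof -
  interpret group G by fact
  have hom: "\<pi> \<in> hom G (GL TYPE('b))" using assms(2) by (simp add: representation_def)
  show mult: "\<pi> (g \<otimes>\<^bsub>G\<^esub> h) = \<pi> g o\<^sub>L \<pi> h" if "g \<in> carrier G" "h \<in> carrier G" for g h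
    using hom_mult[OF hom that] by (simp add: GL_def units_of_def)
  have "\<pi> \<one>\<^bsub>G\<^esub> \<in> carrier (GL TYPE('b))" by (rule hom_carrier[OF hom, THEN subsetD]) simp
  then obtain A where A: "A o\<^sub>L \<pi> \<one>\<^bsub>G\<^esub> = id_blinfun"
    by (auto simp: GL_def units_of_def Units_def)
  have "\<pi> \<one>\<^bsub>G\<^esub> x = x" for x
  proof -
    have "A (\<pi> \<one>\<^bsub>G\<^esub> (\<pi> \<one>\<^bsub>G\<^esub> x)) = A (\<pi> \<one>\<^bsub>G\<^esub> x)"
      using mult[OF one_closed one_closed] by (metis blinfun_apply_blinfun_compose l_one one_closed)
    moreover have "A (\<pi> \<one>\<^bsub>G\<^esub> y) = y" for y
      using A by (metis blinfun_apply_blinfun_compose blinfun_apply_id_blinfun id_apply)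
    ultimately show ?thesis by simp
  qed
  thus "\<pi> \<one>\<^bsub>G\<^esub> = id_blinfun" by (intro blinfun_eqI) simp
qed

lemma powr_add3_le:
  fixes a b c p :: real
  assumes "0 \<le> a" "0 \<le> b" "0 \<le> c" "0 \<le> p"
  shows "(a + b + c) powr p \<le> 3 powr p * (a powr p + b powr p + c powr p)"
proof -
  define m where "m = max a (max b c)"
  have "(a + b + c) powr p \<le> (3 * m) powr p" using assms by (intro powr_mono2) (auto simp: m_def)
  also have "\<dots> = 3 powr p * m powr p" using assms by (simp add: powr_mult m_def)
  also have "m powr p \<le> a powr p + b powr p + c powr p"
    using assms by (auto simp: m_def max_def)
  finally show ?thesis by simp
qed

text \<open>The bound \<open>L\<close> on the operator norms is used instead of an equivalent norm that makes \<open>\<pi>\<close>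
isometric, since passing to such a norm could spoil the modulus of smoothness.\<close>

locale walk_cocycle = symmetric_walk G T
  for G :: "('g, 'm) monoid_scheme" (structure) and T +
  fixes \<pi> :: "'g \<Rightarrow> 'b::banach \<Rightarrow>\<^sub>L 'b" and b :: "'g \<Rightarrow> 'b" and L :: real
  assumes rep: "representation G \<pi>"
    and norm_rep_le: "g \<in> carrier G \<Longrightarrow> norm (\<pi> g) \<le> L"
    and coc: "cocycle G \<pi> b"
begin

definition drift :: 'b where
  "drift = (\<Sum>s\<in>T. b s) /\<^sub>R real (card T)"

text \<open>The sum of \<open>\<pi> g drift\<close> over all positions \<open>g\<close> of the walk except the last one: this is the
predictable part of \<open>b\<close> along the walk. The recursion peels off the first letter because the later
positions are all translated by it.\<close>

fun compensator :: "'g list \<Rightarrow> 'b" where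
  "compensator [] = 0"
| "compensator (s # w) = drift + \<pi> s (compensator w)"

definition martingale :: "'g list \<Rightarrow> 'b" where
  "martingale w = b (endpoint w) - compensator w"

lemma rep_one [simp]: "\<pi> \<one> x = x"
  using representation_one[OF group_axioms rep] by simp

lemma rep_mult: "g \<in> carrier G \<Longrightarrow> h \<in> carrier G \<Longrightarrow> \<pi> (g \<otimes> h) x = \<pi> g (\<pi> h x)"
  using representation_mult[OF group_axioms rep] by simp

lemma L_nonneg: "L \<ge> 0"
  using norm_rep_le[OF one_closed] norm_ge_zero by (rule order_trans[rotated])

lemma norm_rep_apply: "g \<in> carrier G \<Longrightarrow> norm (\<pi> g x) \<le> L * norm x"
  using norm_blinfun[of "\<pi> g" x] norm_rep_le[of g] by (meson mult_right_mono norm_ge_zero order_trans)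

lemma cocycle_mult: "g \<in> carrier G \<Longrightarrow> h \<in> carrier G \<Longrightarrow> b (g \<otimes> h) = b g + \<pi> g (b h)"
  using coc by (simp add: cocycle_def)

lemma cocycle_one [simp]: "b \<one> = 0"
  using cocycle_mult[OF one_closed one_closed] by simp

lemma compensator_snoc:
  "set w \<subseteq> carrier G \<Longrightarrow> compensator (w @ [s]) = compensator w + \<pi> (endpoint w) drift"
  by (induction w) (auto simp: rep_mult blinfun.add_right add.assoc blinfun.zero_right)

lemma rep_inv [simp]: "g \<in> carrier G \<Longrightarrow> \<pi> g (\<pi> (inv g) x) = x"
  using rep_mult[of g "inv g" x] by simp

lemma martingale_snoc:
  assumes "set w \<subseteq> carrier G" "s \<in> carrier G"
  shows "martingale (w @ [s]) = martingale w + \<pi> (endpoint w) (b s - drift)"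
  using assms by (simp add: martingale_def compensator_snoc endpoint_append cocycle_mult blinfun.diff_right)

lemma sum_increments: "(\<Sum>s\<in>T. b s - drift) = 0"
  using card_T_pos by (simp add: sum_subtractf sum_constant_scaleR drift_def)

text \<open>Seen from the endpoint, the positions of the reversed walk are those of the walk itself, with the
starting point left out and the endpoint included instead.\<close>

lemma compensator_reversed:
  "set w \<subseteq> carrier G \<Longrightarrow>
     \<pi> (endpoint w) (compensator (reversed w)) = compensator w + \<pi> (endpoint w) drift - drift"
proof (induction w)
  case Nil
  show ?case by (simp add: reversed_def)
next
  case (Cons s w)
  hence s: "s \<in> carrier G" and w: "set w \<subseteq> carrier G" by auto
  have "compensator (reversed (s # w)) = compensator (reversed w) + \<pi> (inv (endpoint w)) drift"
    using w by (simp add: reversed_Cons compensator_snoc set_reversed endpoint_reversed)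
  hence "\<pi> (endpoint (s # w)) (compensator (reversed (s # w)))
      = \<pi> s (\<pi> (endpoint w) (compensator (reversed w)) + drift)"
    using s w by (simp add: rep_mult blinfun.add_right)
  also have "\<dots> = \<pi> s (compensator w + \<pi> (endpoint w) drift)"
    using Cons.IH[OF w] by simp
  also have "\<dots> = compensator (s # w) + \<pi> (endpoint (s # w)) drift - drift"
    using s w by (simp add: rep_mult blinfun.add_right)
  finally show ?case .
qed

text \<open>By the cocycle identity \<open>\<pi> g (b (inv g)) = - b g\<close>, so subtracting the backward martingale from the
forward one doubles \<open>b\<close>, whereas the two compensators agree up to their boundary terms and cancel.\<close>

lemma forward_backward:
  assumes w: "set w \<subseteq> carrier G"
  shows "2 *\<^sub>R b (endpoint w) =
    martingale w - \<pi> (endpoint w) (martingale (reversed w)) + (drift - \<pi> (endpoint w) drift)"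
proof -
  let ?g = "endpoint w"
  have g: "?g \<in> carrier G" using w by simp
  have "b ?g + \<pi> ?g (b (inv ?g)) = 0" using cocycle_mult[of ?g "inv ?g"] g by simp
  hence "\<pi> ?g (b (inv ?g)) = - b ?g" by (simp add: eq_neg_iff_add_eq_0 add.commute)
  thus ?thesis
    using w by (simp add: martingale_def endpoint_reversed blinfun.diff_right compensator_reversed scaleR_2)
qed

text \<open>Conditionally on a word \<open>w\<close>, the next increment has mean \<open>0\<close> and is the image under
\<open>\<pi> (endpoint w)\<close> of one of finitely many vectors, so each step adds a bounded amount to the \<open>p\<close>-th moment.\<close>

lemma martingale_growth:
  assumes "p_uniformly_smooth p TYPE('b)" "1 < p" "p \<le> 2"
  obtains C where "C \<ge> 0"
    "\<And>n. (\<Sum>w\<in>words n. norm (martingale w) powr p) \<le> C * real n * real (card T ^ n)"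
proof -
  obtain C0 where C0: "C0 \<ge> 0"
    "\<And>(I :: 'g set) x (y :: 'g \<Rightarrow> 'b). finite I \<Longrightarrow> (\<Sum>i\<in>I. y i) = 0 \<Longrightarrow>
       (\<Sum>i\<in>I. norm (x + y i) powr p) \<le> card I * norm x powr p + C0 * (\<Sum>i\<in>I. norm (y i) powr p)"
    using p_uniformly_smooth_centred_sum[OF assms, where 'i = 'g] by blast
  define q where "q = real (card T)"
  have q: "q > 0" using card_T_pos by (simp add: q_def)
  define R where "R = (\<Sum>s\<in>T. (L * norm (b s - drift)) powr p)"
  have R: "R \<ge> 0" by (auto simp: R_def intro: sum_nonneg)
  define C where "C = C0 * R / q"
  have step: "(\<Sum>s\<in>T. norm (martingale (w @ [s])) powr p) \<le> q * norm (martingale w) powr p + C * q"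
    if w: "w \<in> words n" for w n
  proof -
    let ?g = "endpoint w"
    have c: "set w \<subseteq> carrier G" using w by (rule words_carrier)
    have "(\<Sum>s\<in>T. norm (martingale (w @ [s])) powr p)
        = (\<Sum>s\<in>T. norm (martingale w + \<pi> ?g (b s - drift)) powr p)"
      using c T_carrier by (intro sum.cong refl) (auto simp: martingale_snoc)
    also have "\<dots> \<le> q * norm (martingale w) powr p + C0 * (\<Sum>s\<in>T. norm (\<pi> ?g (b s - drift)) powr p)"
      unfolding q_def
      by (rule C0(2)) (simp_all add: finite_T sum_increments blinfun.zero_right flip: blinfun.sum_right)
    also have "(\<Sum>s\<in>T. norm (\<pi> ?g (b s - drift)) powr p) \<le> R"
      unfolding R_def using assms c by (intro sum_mono powr_mono2 norm_rep_apply) auto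
    finally show ?thesis using C0(1) q by (simp add: C_def mult_left_mono)
  qed
  have "(\<Sum>w\<in>words n. norm (martingale w) powr p) \<le> C * real n * q ^ n" for n
  proof (induction n)
    case 0
    have "words 0 = {[]}" by (auto simp: words_def)
    then show ?case using assms by (simp add: martingale_def)
  next
    case (Suc n)
    have "(\<Sum>w\<in>words (Suc n). norm (martingale w) powr p)
        = (\<Sum>w\<in>words n. \<Sum>s\<in>T. norm (martingale (w @ [s])) powr p)" by (rule sum_words_Suc)
    also have "\<dots> \<le> (\<Sum>w\<in>words n. q * norm (martingale w) powr p + C * q)"
      by (intro sum_mono step)
    also have "\<dots> = q * (\<Sum>w\<in>words n. norm (martingale w) powr p) + C * q * q ^ n"
      by (simp add: sum.distrib card_words q_def flip: sum_distrib_left)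
    also have "\<dots> \<le> q * (C * real n * q ^ n) + C * q * q ^ n"
      using Suc q by (intro add_right_mono mult_left_mono) auto
    finally show ?case by (simp add: algebra_simps)
  qed
  moreover have "C \<ge> 0" using C0 R q by (simp add: C_def)
  ultimately show ?thesis using that by (auto simp: q_def)
qed

text \<open>Both martingales in \<open>forward_backward\<close> have the same law because reversal permutes the words of a given
length, and the boundary terms are bounded by a constant.\<close>

lemma cocycle_growth:
  assumes "p_uniformly_smooth p TYPE('b)" "1 < p" "p \<le> 2"
  obtains C where "C \<ge> 0"
    "\<And>n. (\<Sum>w\<in>words n. norm (b (endpoint w)) powr p) \<le> C * (real n + 1) * real (card T ^ n)"
proof -
  obtain C where C: "C \<ge> 0"
    "\<And>n. (\<Sum>w\<in>words n. norm (martingale w) powr p) \<le> C * real n * real (card T ^ n)"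
    using martingale_growth[OF assms] by blast
  define R where "R = ((1 + L) * norm drift) powr p"
  define C' where "C' = 3 powr p * (C + L powr p * C + R)"
  have point: "norm (b (endpoint w)) powr p \<le>
      3 powr p * (norm (martingale w) powr p + L powr p * norm (martingale (reversed w)) powr p + R)"
    if "w \<in> words n" for w n
  proof -
    let ?g = "endpoint w"
    have c: "set w \<subseteq> carrier G" "?g \<in> carrier G" using words_carrier[OF that] by auto
    have "norm (b ?g) \<le> 2 * norm (b ?g)" by simp
    also have "\<dots> = norm (2 *\<^sub>R b ?g)" by simp
    also have "\<dots> \<le> norm (martingale w) + norm (\<pi> ?g (martingale (reversed w)))
        + (norm drift + norm (\<pi> ?g drift))"
      unfolding forward_backward[OF c(1)]
      by (intro order_trans[OF norm_triangle_ineq] add_mono norm_triangle_ineq4)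
    also have "\<dots> \<le> norm (martingale w) + L * norm (martingale (reversed w)) + (1 + L) * norm drift"
      using norm_rep_apply[OF c(2), of "martingale (reversed w)"] norm_rep_apply[OF c(2), of drift]
      by (simp add: algebra_simps)
    finally have "norm (b ?g) powr p \<le>
        (norm (martingale w) + L * norm (martingale (reversed w)) + (1 + L) * norm drift) powr p"
      using assms by (intro powr_mono2) auto
    also have "\<dots> \<le> 3 powr p * (norm (martingale w) powr p
        + (L * norm (martingale (reversed w))) powr p + R)"
      unfolding R_def using assms L_nonneg by (intro powr_add3_le) auto
    finally show ?thesis using L_nonneg by (simp add: powr_mult)
  qed
  show ?thesis
  proof (rule that[of C'])
    show "C' \<ge> 0" using C by (simp add: C'_def R_def)
    fix n
    define Q where "Q = real (card T ^ n)"
    have "(\<Sum>w\<in>words n. norm (b (endpoint w)) powr p) \<le> (\<Sum>w\<in>words n.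
        3 powr p * (norm (martingale w) powr p + L powr p * norm (martingale (reversed w)) powr p + R))"
      by (intro sum_mono point)
    also have "\<dots> = 3 powr p * ((\<Sum>w\<in>words n. norm (martingale w) powr p)
        + L powr p * (\<Sum>w\<in>words n. norm (martingale (reversed w)) powr p) + R * Q)"
      by (simp add: sum.distrib card_words Q_def flip: sum_distrib_left)
    also have "(\<Sum>w\<in>words n. norm (martingale (reversed w)) powr p)
        = (\<Sum>w\<in>words n. norm (martingale w) powr p)"
      by (rule sum_words_reversed)
    also have "3 powr p * ((\<Sum>w\<in>words n. norm (martingale w) powr p)
        + L powr p * (\<Sum>w\<in>words n. norm (martingale w) powr p) + R * Q)
        \<le> 3 powr p * (C * real n * Q + L powr p * (C * real n * Q) + R * Q)"
      unfolding Q_def by (intro mult_left_mono add_mono C order_refl) auto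
    also have "\<dots> \<le> 3 powr p * (C * (real n + 1) * Q + L powr p * (C * (real n + 1) * Q) + R * (real n + 1) * Q)"
      using C by (intro mult_left_mono add_mono mult_right_mono) (auto simp: Q_def R_def mult_le_cancel_left1)
    also have "\<dots> = C' * (real n + 1) * Q" by (simp add: C'_def algebra_simps)
    finally show "(\<Sum>w\<in>words n. norm (b (endpoint w)) powr p) \<le> C' * (real n + 1) * real (card T ^ n)"
      by (simp add: Q_def)
  qed
qed

end

section \<open>Invariant means from almost invariant measures\<close>

text \<open>How closed conditions pass to the limit when only cluster points are available.\<close>

lemma cluster_point_in_closed:
  assumes "inf (nhds x) F \<noteq> bot" "closed C" "eventually (\<lambda>y. y \<in> C) F"
  shows "x \<in> C"
proof (rule ccontr)
  assume "x \<notin> C"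
  hence "eventually (\<lambda>y. y \<in> - C) (nhds x)"
    using assms by (intro eventually_nhds_in_open) (auto simp: open_Compl)
  hence "eventually (\<lambda>y. False) (inf (nhds x) F)"
    unfolding eventually_inf using assms(3) by fastforce
  with assms(1) show False by (simp add: eventually_False)
qed

lemma ell_infty_iff: "f \<in> ell_infty G \<longleftrightarrow> (\<exists>K. \<forall>x\<in>carrier G. \<bar>f x\<bar> \<le> K)"
  by (auto simp: ell_infty_def bounded_iff)

lemma (in group) ell_infty_translate:
  assumes "f \<in> ell_infty G" "g \<in> carrier G"
  shows "(\<lambda>x. f (g \<otimes> x)) \<in> ell_infty G"
  using assms unfolding ell_infty_iff by (metis m_closed)

text \<open>Reiter's condition for \<open>S\<close>: finitely supported probability measures that are almost fixed by
translation. The \<open>l\<^sup>1\<close>-distance between a measure and its translate is expressed by testing against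
bounded functions.\<close>

definition almost_invariant_measures :: "('g, 'm) monoid_scheme \<Rightarrow> 'g set \<Rightarrow> bool" where
  "almost_invariant_measures G S \<longleftrightarrow>
     (\<forall>\<epsilon>>0. \<exists>X \<phi>. finite X \<and> X \<subseteq> carrier G \<and> (\<forall>x\<in>X. 0 \<le> \<phi> x) \<and> (\<Sum>x\<in>X. \<phi> x) = 1 \<and>
        (\<forall>s\<in>S. \<forall>f K. (\<forall>x\<in>carrier G. \<bar>f x\<bar> \<le> K) \<longrightarrow>
           \<bar>(\<Sum>x\<in>X. \<phi> x * f (inv\<^bsub>G\<^esub> s \<otimes>\<^bsub>G\<^esub> x)) - (\<Sum>x\<in>X. \<phi> x * f x)\<bar> \<le> \<epsilon> * (K::real)))"

text \<open>The measures are points of a product of compact intervals, one for each bounded function. A cluster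
point of a sequence of measures with invariance defect tending to \<open>0\<close> inherits every closed condition
that involves finitely many coordinates, and the properties of an invariant mean are all of this kind.\<close>

lemma exists_invariant_mean:
  fixes G :: "('g, 'm) monoid_scheme" (structure)
  assumes "group G" "almost_invariant_measures G S" "S \<subseteq> carrier G"
  obtains M where
    "\<And>f h. f \<in> ell_infty G \<Longrightarrow> h \<in> ell_infty G \<Longrightarrow> M (\<lambda>x. f x + h x) = M f + M h"
    "\<And>c f. f \<in> ell_infty G \<Longrightarrow> M (\<lambda>x. c * f x) = c * M f"
    "\<And>f. f \<in> ell_infty G \<Longrightarrow> \<forall>x\<in>carrier G. 0 \<le> f x \<Longrightarrow> 0 \<le> M f"
    "M (\<lambda>_. 1) = (1::real)"
    "\<And>s f. s \<in> S \<Longrightarrow> f \<in> ell_infty G \<Longrightarrow> M (\<lambda>x. f (inv s \<otimes> x)) = M f"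
proof -
  interpret group G by fact
  define P where "P n X \<phi> \<longleftrightarrow> finite X \<and> X \<subseteq> carrier G \<and> (\<forall>x\<in>X. 0 \<le> \<phi> x) \<and> (\<Sum>x\<in>X. \<phi> x) = 1 \<and>
        (\<forall>s\<in>S. \<forall>f K. (\<forall>x\<in>carrier G. \<bar>f x\<bar> \<le> K) \<longrightarrow>
           \<bar>(\<Sum>x\<in>X. \<phi> x * f (inv s \<otimes> x)) - (\<Sum>x\<in>X. \<phi> x * f x)\<bar> \<le> inverse (real (Suc n)) * K)"
    for n X and \<phi> :: "'g \<Rightarrow> real"
  have "\<exists>X \<phi>. P n X \<phi>" for n
    using assms(2) unfolding almost_invariant_measures_def P_def
    by (elim allE[of _ "inverse (real (Suc n))"]) simp
  then obtain X \<phi> where P: "\<And>n. P n (X n) (\<phi> n)" by metis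
  have X: "\<And>n. finite (X n)" "\<And>n. X n \<subseteq> carrier G"
    and \<phi>: "\<And>n x. x \<in> X n \<Longrightarrow> 0 \<le> \<phi> n x" "\<And>n. (\<Sum>x\<in>X n. \<phi> n x) = 1"
    and inv: "\<And>n s f K. s \<in> S \<Longrightarrow> (\<And>x. x \<in> carrier G \<Longrightarrow> \<bar>f x\<bar> \<le> K) \<Longrightarrow>
       \<bar>(\<Sum>x\<in>X n. \<phi> n x * f (inv s \<otimes> x)) - (\<Sum>x\<in>X n. \<phi> n x * f x)\<bar> \<le> inverse (real (Suc n)) * K"
    using P unfolding P_def by simp_all
  \<comment> \<open>Coordinates of unbounded functions are set to \<open>0\<close>, so that all coordinates stay in a compact interval.\<close>
  define A where "A n f = (if f \<in> ell_infty G then \<Sum>x\<in>X n. \<phi> n x * f x else 0)" for n f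
  define bnd where "bnd f = (if f \<in> ell_infty G then SOME K. \<forall>x\<in>carrier G. \<bar>f x\<bar> \<le> K else 0)" for f
  have bnd: "\<bar>f x\<bar> \<le> bnd f" if "f \<in> ell_infty G" "x \<in> carrier G" for f x
  proof -
    have "\<forall>x\<in>carrier G. \<bar>f x\<bar> \<le> (SOME K. \<forall>x\<in>carrier G. \<bar>f x\<bar> \<le> K)"
      by (rule someI_ex) (use that in \<open>simp add: ell_infty_iff\<close>)
    with that show ?thesis by (simp add: bnd_def)
  qed
  have A_bnd: "\<bar>A n f\<bar> \<le> bnd f" for n f
  proof (cases "f \<in> ell_infty G")
    case True
    have "\<bar>\<Sum>x\<in>X n. \<phi> n x * f x\<bar> \<le> (\<Sum>x\<in>X n. \<bar>\<phi> n x * f x\<bar>)" by (rule sum_abs)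
    also have "\<dots> \<le> (\<Sum>x\<in>X n. \<phi> n x * bnd f)"
    proof (rule sum_mono)
      fix x assume "x \<in> X n"
      with X(2)[of n] \<phi>(1)[of x n] bnd[OF True, of x] show "\<bar>\<phi> n x * f x\<bar> \<le> \<phi> n x * bnd f"
        by (auto simp: abs_mult intro!: mult_left_mono)
    qed
    also have "\<dots> = bnd f" using \<phi>(2)[of n] by (simp flip: sum_distrib_right)
    finally show ?thesis using True by (simp add: A_def)
  qed (simp add: A_def bnd_def)
  define Q where "Q = PiE UNIV (\<lambda>f. {- bnd f .. bnd f})"
  have "compactin (product_topology (\<lambda>_. euclidean) UNIV) Q"
    unfolding Q_def compactin_PiE by simp
  hence "compact Q" by (simp add: euclidean_product_topology)
  moreover have "filtermap A sequentially \<noteq> bot" by (simp add: filtermap_bot_iff)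
  moreover have "eventually (\<lambda>m. m \<in> Q) (filtermap A sequentially)"
  proof -
    have "- bnd f \<le> A n f" "A n f \<le> bnd f" for n f using A_bnd[of n f] by auto
    hence "A n \<in> Q" for n by (simp add: Q_def PiE_iff)
    thus ?thesis by (simp add: eventually_filtermap)
  qed
  ultimately obtain M where M: "inf (nhds M) (filtermap A sequentially) \<noteq> bot"
    unfolding compact_filter by metis
  have closed_step: "M \<in> C" if "closed C" "eventually (\<lambda>n. A n \<in> C) sequentially" for C
    using cluster_point_in_closed[OF M that(1)] that(2) by (simp add: eventually_filtermap)
  show ?thesis
  proof (rule that[of M])
    fix f h assume f: "f \<in> ell_infty G" and h: "h \<in> ell_infty G"
    have fh: "(\<lambda>x. f x + h x) \<in> ell_infty G"
      using f h unfolding ell_infty_def by (auto intro: bounded_plus_comp)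
    have "M \<in> {m. m (\<lambda>x. f x + h x) = m f + m h}"
    proof (rule closed_step)
      show "closed {m :: ('g \<Rightarrow> real) \<Rightarrow> real. m (\<lambda>x. f x + h x) = m f + m h}"
        by (intro closed_Collect_eq continuous_intros) auto
    qed (use f h fh in \<open>simp add: A_def distrib_left sum.distrib\<close>)
    thus "M (\<lambda>x. f x + h x) = M f + M h" by simp
  next
    fix c f assume f: "f \<in> ell_infty G"
    have cf: "(\<lambda>x. c * f x) \<in> ell_infty G"
      using f unfolding ell_infty_iff by (metis abs_mult abs_ge_zero mult_left_mono)
    have "M \<in> {m. m (\<lambda>x. c * f x) = c * m f}"
    proof (rule closed_step)
      show "closed {m :: ('g \<Rightarrow> real) \<Rightarrow> real. m (\<lambda>x. c * f x) = c * m f}"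
        by (intro closed_Collect_eq continuous_intros) auto
    qed (use f cf in \<open>simp add: A_def sum_distrib_left mult.left_commute\<close>)
    thus "M (\<lambda>x. c * f x) = c * M f" by simp
  next
    fix f assume f: "f \<in> ell_infty G" "\<forall>x\<in>carrier G. 0 \<le> f x"
    have "M \<in> {m. 0 \<le> m f}"
    proof (rule closed_step)
      show "closed {m :: ('g \<Rightarrow> real) \<Rightarrow> real. 0 \<le> m f}"
        by (intro closed_Collect_le continuous_intros) auto
      have "0 \<le> A n f" for n
        unfolding A_def using f \<phi>(1)[of _ n] X(2)[of n]
        by (auto intro!: sum_nonneg mult_nonneg_nonneg)
      thus "eventually (\<lambda>n. A n \<in> {m. 0 \<le> m f}) sequentially" by simp
    qed
    thus "0 \<le> M f" by simp
  next
    have one: "(\<lambda>_. 1) \<in> ell_infty G" by (auto simp: ell_infty_iff)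
    have "M \<in> {m. m (\<lambda>_. 1) = 1}"
    proof (rule closed_step)
      show "closed {m :: ('g \<Rightarrow> real) \<Rightarrow> real. m (\<lambda>_. 1) = 1}"
        by (intro closed_Collect_eq continuous_intros) auto
    qed (use one \<phi>(2) in \<open>simp add: A_def\<close>)
    thus "M (\<lambda>_. 1) = 1" by simp
  next
    fix s f assume s: "s \<in> S" and f: "f \<in> ell_infty G"
    have sf: "(\<lambda>x. f (inv s \<otimes> x)) \<in> ell_infty G"
      using s f assms(3) by (intro ell_infty_translate) auto
    have "\<bar>M (\<lambda>x. f (inv s \<otimes> x)) - M f\<bar> \<le> \<epsilon>" if "\<epsilon> > 0" for \<epsilon>
    proof -
      have "M \<in> {m. \<bar>m (\<lambda>x. f (inv s \<otimes> x)) - m f\<bar> \<le> \<epsilon>}"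
      proof (rule closed_step)
        show "closed {m :: ('g \<Rightarrow> real) \<Rightarrow> real. \<bar>m (\<lambda>x. f (inv s \<otimes> x)) - m f\<bar> \<le> \<epsilon>}"
          by (intro closed_Collect_le continuous_intros) auto
        have "(\<lambda>n. inverse (real (Suc n)) * bnd f) \<longlonglongrightarrow> 0 * bnd f"
          by (intro tendsto_intros LIMSEQ_inverse_real_of_nat)
        hence "eventually (\<lambda>n. inverse (real (Suc n)) * bnd f < \<epsilon>) sequentially"
          using that by (auto dest: order_tendstoD(2))
        thus "eventually (\<lambda>n. A n \<in> {m. \<bar>m (\<lambda>x. f (inv s \<otimes> x)) - m f\<bar> \<le> \<epsilon>}) sequentially"
        proof eventually_elim
          case (elim n)
          have "\<bar>(\<Sum>x\<in>X n. \<phi> n x * f (inv s \<otimes> x)) - (\<Sum>x\<in>X n. \<phi> n x * f x)\<bar>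
              \<le> inverse (real (Suc n)) * bnd f"
            by (rule inv[OF s]) (rule bnd[OF f])
          with elim show ?case using f sf by (simp add: A_def)
        qed
      qed
      thus ?thesis by simp
    qed
    hence "\<bar>M (\<lambda>x. f (inv s \<otimes> x)) - M f\<bar> \<le> 0" by (rule field_le_epsilon) simp
    thus "M (\<lambda>x. f (inv s \<otimes> x)) = M f" by simp
  qed
qed

text \<open>The group elements that fix a mean form a subgroup, so invariance under generators suffices.\<close>

lemma amenable_if_almost_invariant_measures:
  fixes G :: "('g, 'm) monoid_scheme" (structure)
  assumes "group G" and ai: "almost_invariant_measures G T"
    and T: "T \<subseteq> carrier G" "\<And>s. s \<in> T \<Longrightarrow> inv s \<in> T" "generate G T = carrier G"
  shows "amenable G"
proof -
  interpret group G by fact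
  obtain M where
    add: "\<And>f h. f \<in> ell_infty G \<Longrightarrow> h \<in> ell_infty G \<Longrightarrow> M (\<lambda>x. f x + h x) = M f + M h"
    and scale: "\<And>c f. f \<in> ell_infty G \<Longrightarrow> M (\<lambda>x. c * f x) = c * M f"
    and pos: "\<And>f. f \<in> ell_infty G \<Longrightarrow> \<forall>x\<in>carrier G. 0 \<le> f x \<Longrightarrow> 0 \<le> M f"
    and one: "M (\<lambda>_. 1) = (1::real)"
    and mean_inv: "\<And>s f. s \<in> T \<Longrightarrow> f \<in> ell_infty G \<Longrightarrow> M (\<lambda>x. f (inv s \<otimes> x)) = M f"
    by (rule exists_invariant_mean[OF assms(1,2) T(1)]) blast
  \<comment> \<open>Positivity makes the mean blind to values outside the carrier.\<close>
  have le: "M f \<le> M h" if "f \<in> ell_infty G" "h \<in> ell_infty G" "\<And>x. x \<in> carrier G \<Longrightarrow> f x = h x" for f h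
  proof -
    have mf: "(\<lambda>x. (-1) * f x) \<in> ell_infty G" using that(1) by (auto simp: ell_infty_iff)
    have "(\<lambda>x. h x + (-1) * f x) \<in> ell_infty G"
      using that unfolding ell_infty_iff by (auto intro!: exI[of _ 0])
    hence "0 \<le> M (\<lambda>x. h x + (-1) * f x)" using that by (intro pos) auto
    also have "\<dots> = M h - M f" using add[OF that(2) mf] scale[OF that(1), of "-1"] by simp
    finally show ?thesis by simp
  qed
  have cong: "M f = M h" if "f \<in> ell_infty G" "\<And>x. x \<in> carrier G \<Longrightarrow> f x = h x" for f h
  proof -
    have "h \<in> ell_infty G" using that unfolding ell_infty_iff by metis
    with that show ?thesis using le[of f h] le[of h f] by force
  qed
  have gen: "g \<in> carrier G \<and> (\<forall>f\<in>ell_infty G. M (\<lambda>x. f (inv g \<otimes> x)) = M f)" if "g \<in> generate G T" for g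
    using that
  proof (induction rule: generate.induct)
    case one
    have "M f = M (\<lambda>x. f (inv \<one> \<otimes> x))" if "f \<in> ell_infty G" for f
      by (rule cong[OF that]) simp
    thus ?case by simp
  next
    case (incl s)
    then show ?case using mean_inv T by auto
  next
    case (inv s)
    then show ?case using mean_inv T(1) T(2)[of s] by auto
  next
    case (eng g h)
    have "M (\<lambda>x. f (inv (g \<otimes> h) \<otimes> x)) = M f" if f: "f \<in> ell_infty G" for f
    proof -
      have hf: "(\<lambda>x. f (inv h \<otimes> x)) \<in> ell_infty G" using f eng.IH by (intro ell_infty_translate) auto
      have ghf: "(\<lambda>x. f (inv h \<otimes> (inv g \<otimes> x))) \<in> ell_infty G"
        using ell_infty_translate[OF hf, of "inv g"] eng.IH by simp
      have "M (\<lambda>x. f (inv h \<otimes> (inv g \<otimes> x))) = M (\<lambda>x. f (inv (g \<otimes> h) \<otimes> x))"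
        by (rule cong[OF ghf]) (use eng.IH in \<open>simp add: inv_mult_group m_assoc\<close>)
      moreover have "M (\<lambda>x. f (inv h \<otimes> (inv g \<otimes> x))) = M (\<lambda>x. f (inv h \<otimes> x))"
        using eng.IH(1)[THEN conjunct2, THEN bspec, OF hf] by simp
      ultimately show ?thesis using eng.IH f by simp
    qed
    with eng.IH show ?case by simp
  qed
  have "left_invariant_mean G M"
    unfolding left_invariant_mean_def using add scale pos one gen T(3) by auto
  thus ?thesis unfolding amenable_def by blast
qed

section \<open>Almost invariant measures from a slow walk\<close>

context symmetric_walk begin

text \<open>Change of variables for a function supported in \<open>X\<close>; \<open>Y\<close> is any finite set that contains the translated support.\<close>

lemma sum_translate:
  assumes X: "finite X" "X \<subseteq> carrier G" and Y: "finite Y" "Y \<subseteq> carrier G"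
    and t: "t \<in> carrier G" and XY: "\<And>x. x \<in> X \<Longrightarrow> t \<otimes> x \<in> Y"
    and zero: "\<And>x. x \<in> carrier G \<Longrightarrow> x \<notin> X \<Longrightarrow> \<phi> x = (0::real)"
  shows "(\<Sum>y\<in>Y. \<phi> (inv t \<otimes> y) * f y) = (\<Sum>x\<in>X. \<phi> x * f (t \<otimes> x))"
proof -
  have cancel: "inv t \<otimes> (t \<otimes> x) = x" "t \<otimes> (inv t \<otimes> x) = x" if "x \<in> carrier G" for x
    using that t by (simp_all flip: m_assoc)
  have "(\<Sum>x\<in>X. \<phi> x * f (t \<otimes> x)) = (\<Sum>x\<in>X. \<phi> (inv t \<otimes> (t \<otimes> x)) * f (t \<otimes> x))"
    using X cancel by (intro sum.cong) auto
  also have "\<dots> = (\<Sum>y\<in>(\<otimes>) t ` X. \<phi> (inv t \<otimes> y) * f y)"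
  proof -
    have "inj_on ((\<otimes>) t) X" using X cancel(1) by (metis inj_onI subsetD)
    thus ?thesis by (simp add: sum.reindex)
  qed
  also have "\<dots> = (\<Sum>y\<in>Y. \<phi> (inv t \<otimes> y) * f y)"
  proof (rule sum.mono_neutral_left)
    show "\<forall>y\<in>Y - (\<otimes>) t ` X. \<phi> (inv t \<otimes> y) * f y = 0"
    proof
      fix y assume y: "y \<in> Y - (\<otimes>) t ` X"
      hence c: "y \<in> carrier G" using Y by blast
      have "inv t \<otimes> y \<notin> X" using y cancel(2)[OF c] by force
      thus "\<phi> (inv t \<otimes> y) * f y = 0" using c t zero by simp
    qed
  qed (use XY Y in auto)
  finally show ?thesis by simp
qed

lemma visits_zero_one: "visits 0 \<one> = 1"
proof -
  have "{w \<in> words 0. endpoint w = \<one>} = {[]}" by (auto simp: words_def)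
  thus ?thesis by (simp add: visits_def)
qed

lemma visits_even_pos: "visits (n + n) \<one> > 0"
proof -
  have "visits n \<one> \<noteq> 0"
    using one_reach[of n] by (auto simp: visits_def reach_def card_eq_0_iff)
  hence "0 < visits n \<one>" using visits_nonneg[of n \<one>] by linarith
  hence "0 < visits n \<one> * visits n \<one>" by simp
  also have "\<dots> \<le> (\<Sum>g\<in>reach n. visits n g * visits n g)"
    by (rule member_le_sum[OF one_reach]) auto
  finally show ?thesis by (simp add: sum_visits_mult)
qed

text \<open>Summing the squared \<open>l\<^sup>2\<close>-displacement over all words of length \<open>2\<close> gives exactly the right-hand
side, by self-adjointness. The element \<open>t\<close> occurs in that sum as the endpoint of \<open>[t, \<one>]\<close>. Two steps
are used instead of one because then only closed words of even length occur.\<close>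

lemma visits_displacement:
  assumes t: "t \<in> T"
  shows "(\<Sum>g\<in>reach (n + 2). (visits n (inv t \<otimes> g) - visits n g)\<^sup>2)
           \<le> 2 * (real (card T ^ 2) * visits (n + n) \<one> - visits (n + (2 + n)) \<one>)"
proof -
  define Y where "Y = reach (n + 2)"
  define D where "D = visits (n + n) \<one>"
  define \<Delta> where "\<Delta> u = (\<Sum>g\<in>Y. (visits n (inv u \<otimes> g) - visits n g)\<^sup>2)" for u
  have Y: "finite Y" "Y \<subseteq> carrier G" "reach n \<subseteq> Y"
    unfolding Y_def using reach_carrier reach_mono[of n "n + 2"] by auto
  have D: "(\<Sum>g\<in>Y. visits n g * visits n g) = D"
    unfolding D_def using Y by (intro sum_visits_mult) auto
  have \<Delta>: "\<Delta> (endpoint u) = 2 * D - 2 * (\<Sum>g\<in>Y. visits n g * visits n (inv (endpoint u) \<otimes> g))"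
    if u: "u \<in> words 2" for u
  proof -
    have c: "endpoint u \<in> carrier G" using words_carrier[OF u] by simp
    have "(\<Sum>g\<in>Y. (visits n (inv (endpoint u) \<otimes> g) * visits n (inv (endpoint u) \<otimes> g)) * 1)
            = (\<Sum>g\<in>reach n. (visits n g * visits n g) * 1)"
    proof (rule sum_translate)
      fix x assume "x \<in> reach n"
      moreover have "endpoint u \<in> reach 2" using u by (auto simp: reach_def)
      ultimately have "endpoint u \<otimes> x \<in> reach (2 + n)" by (intro reach_mult)
      thus "endpoint u \<otimes> x \<in> Y" by (simp add: Y_def add.commute)
    qed (use Y c reach_carrier visits_eq_0 in auto)
    hence "(\<Sum>g\<in>Y. visits n (inv (endpoint u) \<otimes> g) * visits n (inv (endpoint u) \<otimes> g)) = D"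
      by (simp add: sum_visits_mult D_def)
    with D show ?thesis
      unfolding \<Delta>_def by (simp add: power2_diff power2_eq_square sum.distrib sum_subtractf
          sum_distrib_left algebra_simps)
  qed
  have "[t, \<one>] \<in> words 2" using t one_T by (simp add: words_def)
  moreover have "endpoint [t, \<one>] = t" using t T_carrier by auto
  ultimately have "\<Delta> t \<le> (\<Sum>u\<in>words 2. \<Delta> (endpoint u))"
    using member_le_sum[of "[t, \<one>]" "words 2" "\<lambda>u. \<Delta> (endpoint u)"]
    by (simp add: \<Delta>_def sum_nonneg)
  also have "\<dots> = (\<Sum>u\<in>words 2. 2 * D - 2 * (\<Sum>g\<in>Y. visits n g * visits n (inv (endpoint u) \<otimes> g)))"
    by (intro sum.cong refl \<Delta>)
  also have "\<dots> = 2 * (real (card T ^ 2) * D)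
      - 2 * (\<Sum>u\<in>words 2. \<Sum>g\<in>Y. visits n g * visits n (inv (endpoint u) \<otimes> g))"
    by (simp add: sum_subtractf card_words flip: sum_distrib_left)
  also have "(\<Sum>u\<in>words 2. \<Sum>g\<in>Y. visits n g * visits n (inv (endpoint u) \<otimes> g))
      = (\<Sum>g\<in>Y. visits n g * visits (2 + n) g)"
  proof (subst sum.swap, rule sum.cong[OF refl])
    fix g assume "g \<in> Y"
    with Y(2) have "visits (2 + n) g = (\<Sum>u\<in>words 2. visits n (inv (endpoint u) \<otimes> g))"
      by (intro visits_append) auto
    thus "(\<Sum>u\<in>words 2. visits n g * visits n (inv (endpoint u) \<otimes> g))
        = visits n g * visits (2 + n) g"
      by (simp only: sum_distrib_left)
  qed
  also have "\<dots> = visits (n + (2 + n)) \<one>" using Y by (intro sum_visits_mult) auto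
  finally show ?thesis by (simp add: \<Delta>_def Y_def D_def)
qed

text \<open>The measures are \<open>(visits n g)\<^sup>2\<close>, normalised. Factoring a difference of squares, the Cauchy-Schwarz
inequality bounds their \<open>l\<^sup>1\<close>-displacement by the \<open>l\<^sup>2\<close>-displacement of \<open>visits n\<close>.\<close>

lemma almost_invariant_measures_if_ratio:
  assumes ratio: "\<And>\<delta>. 0 < \<delta> \<Longrightarrow> \<delta> < 1 \<Longrightarrow>
     \<exists>n. (1 - \<delta>) * real (card T ^ 2) * visits (n + n) \<one> \<le> visits (n + (2 + n)) \<one>"
  shows "almost_invariant_measures G T"
  unfolding almost_invariant_measures_def
proof (intro allI impI)
  fix \<epsilon> :: real assume \<epsilon>: "\<epsilon> > 0"
  define q where "q = real (card T)"
  have q: "q > 0" using card_T_pos by (simp add: q_def)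
  \<comment> \<open>Chosen so that \<open>sqrt (8 * \<delta>) * q \<le> \<epsilon>\<close>, which is the estimate that comes out below.\<close>
  define \<delta> where "\<delta> = min (1/2) ((\<epsilon> / q)\<^sup>2 / 8)"
  have \<delta>: "0 < \<delta>" "\<delta> < 1" "\<delta> \<le> (\<epsilon> / q)\<^sup>2 / 8" using \<epsilon> q by (auto simp: \<delta>_def)
  obtain n where n: "(1 - \<delta>) * q\<^sup>2 * visits (n + n) \<one> \<le> visits (n + (2 + n)) \<one>"
    using ratio[OF \<delta>(1,2)] by (auto simp: q_def)
  define V where "V = visits n"
  define D where "D = visits (n + n) \<one>"
  define X where "X = reach n"
  define Y where "Y = reach (n + 2)"
  define \<phi> where "\<phi> g = (V g)\<^sup>2 / D" for g
  have D: "D > 0" using visits_even_pos by (simp add: D_def)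
  have X: "finite X" "X \<subseteq> carrier G" and Y: "finite Y" "Y \<subseteq> carrier G" and XY: "X \<subseteq> Y"
    unfolding X_def Y_def using reach_carrier reach_mono[of n "n + 2"] by auto
  have zero: "V x = 0" if "x \<notin> X" for x using that visits_eq_0 by (simp add: V_def X_def)
  have sumX: "(\<Sum>g\<in>X. (V g)\<^sup>2) = D"
    unfolding V_def X_def D_def power2_eq_square by (intro sum_visits_mult) auto
  have sumY: "(\<Sum>g\<in>Y. (V g)\<^sup>2) = D"
    using sumX sum.mono_neutral_left[OF Y(1) XY, of "\<lambda>g. (V g)\<^sup>2"] zero by simp
  have "\<bar>(\<Sum>x\<in>X. \<phi> x * f (inv s \<otimes> x)) - (\<Sum>x\<in>X. \<phi> x * f x)\<bar> \<le> \<epsilon> * K"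
    if s: "s \<in> T" and f: "\<And>x. x \<in> carrier G \<Longrightarrow> \<bar>f x\<bar> \<le> K" for s f K
  proof -
    \<comment> \<open>Moving the translation from the function to the measure replaces \<open>s\<close> by its inverse.\<close>
    define t where "t = inv s"
    have t: "t \<in> T" "t \<in> carrier G" using s inv_T T_carrier by (auto simp: t_def)
    have K: "K \<ge> 0" using f[OF one_closed] by simp
    define W where "W g = V (inv t \<otimes> g)" for g
    have tX: "t \<otimes> x \<in> Y" if "x \<in> X" for x
    proof -
      have "t \<in> reach 2" using t(1) T_reach reach_mono[of 1 2] by auto
      hence "t \<otimes> x \<in> reach (2 + n)" using that by (intro reach_mult) (auto simp: X_def)
      thus ?thesis by (simp add: Y_def add.commute)
    qed
    have "(\<Sum>g\<in>Y. (V (inv t \<otimes> g))\<^sup>2 * 1) = (\<Sum>g\<in>X. (V g)\<^sup>2 * 1)"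
      by (rule sum_translate[OF X Y t(2) tX]) (auto simp: zero)
    hence sumW: "(\<Sum>g\<in>Y. (W g)\<^sup>2) = D" by (simp add: sumX W_def)
    have diff: "(\<Sum>g\<in>Y. (W g - V g)\<^sup>2) \<le> 2 * (\<delta> * q\<^sup>2 * D)"
    proof -
      have "(\<Sum>g\<in>Y. (W g - V g)\<^sup>2) \<le> 2 * (q\<^sup>2 * D - visits (n + (2 + n)) \<one>)"
        using visits_displacement[OF t(1), of n] by (simp add: W_def V_def Y_def D_def q_def)
      also have "\<dots> \<le> 2 * (q\<^sup>2 * D - (1 - \<delta>) * q\<^sup>2 * D)" using n by (simp add: D_def)
      finally show ?thesis by (simp add: algebra_simps)
    qed
    have plus: "(\<Sum>g\<in>Y. (W g + V g)\<^sup>2) \<le> 4 * D"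
    proof -
      have "(\<Sum>g\<in>Y. (W g + V g)\<^sup>2) \<le> (\<Sum>g\<in>Y. 2 * (W g)\<^sup>2 + 2 * (V g)\<^sup>2)"
      proof (rule sum_mono)
        fix g show "(W g + V g)\<^sup>2 \<le> 2 * (W g)\<^sup>2 + 2 * (V g)\<^sup>2"
          using zero_le_power2[of "W g - V g"] by (simp add: power2_eq_square algebra_simps)
      qed
      thus ?thesis by (simp add: sum.distrib sumY sumW flip: sum_distrib_left)
    qed
    have "(\<Sum>g\<in>Y. \<bar>W g - V g\<bar> * \<bar>W g + V g\<bar>)\<^sup>2
            \<le> (\<Sum>g\<in>Y. \<bar>W g - V g\<bar>\<^sup>2) * (\<Sum>g\<in>Y. \<bar>W g + V g\<bar>\<^sup>2)"
      by (rule Cauchy_Schwarz_ineq_sum)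
    also have "\<dots> \<le> (2 * (\<delta> * q\<^sup>2 * D)) * (4 * D)"
      using diff plus D \<delta> q by (intro mult_mono) (auto intro!: sum_nonneg)
    also have "\<dots> = 8 * \<delta> * (q * D)\<^sup>2" by (simp add: power2_eq_square)
    also have "\<dots> \<le> (\<epsilon> / q)\<^sup>2 * (q * D)\<^sup>2" using \<delta>(3) by (intro mult_right_mono) auto
    also have "\<dots> = (\<epsilon> * D)\<^sup>2" using q by (simp add: power_divide power_mult_distrib)
    finally have l1: "(\<Sum>g\<in>Y. \<bar>W g - V g\<bar> * \<bar>W g + V g\<bar>) \<le> \<epsilon> * D"
      by (rule power2_le_imp_le) (use \<epsilon> D in simp)
    have "(\<Sum>x\<in>X. \<phi> x * f (t \<otimes> x)) = (\<Sum>y\<in>Y. \<phi> (inv t \<otimes> y) * f y)"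
      by (rule sum_translate[OF X Y t(2) tX, symmetric]) (auto simp: \<phi>_def zero)
    moreover have "(\<Sum>x\<in>X. \<phi> x * f x) = (\<Sum>y\<in>Y. \<phi> y * f y)"
      using Y(1) XY by (rule sum.mono_neutral_left) (auto simp: \<phi>_def zero)
    ultimately have "\<bar>(\<Sum>x\<in>X. \<phi> x * f (t \<otimes> x)) - (\<Sum>x\<in>X. \<phi> x * f x)\<bar>
        = \<bar>\<Sum>y\<in>Y. (\<phi> (inv t \<otimes> y) - \<phi> y) * f y\<bar>"
      by (simp add: left_diff_distrib sum_subtractf)
    also have "\<dots> \<le> (\<Sum>y\<in>Y. \<bar>(\<phi> (inv t \<otimes> y) - \<phi> y) * f y\<bar>)" by (rule sum_abs)
    also have "\<dots> \<le> (\<Sum>y\<in>Y. (\<bar>W y - V y\<bar> * \<bar>W y + V y\<bar>) * (K / D))"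
    proof (rule sum_mono)
      fix y assume y: "y \<in> Y"
      have "\<phi> (inv t \<otimes> y) - \<phi> y = (W y - V y) * (W y + V y) / D"
        by (simp add: \<phi>_def W_def power2_eq_square algebra_simps diff_divide_distrib add_divide_distrib)
      hence "\<bar>(\<phi> (inv t \<otimes> y) - \<phi> y) * f y\<bar> = (\<bar>W y - V y\<bar> * \<bar>W y + V y\<bar>) / D * \<bar>f y\<bar>"
        using D by (simp add: abs_mult)
      also have "\<dots> \<le> (\<bar>W y - V y\<bar> * \<bar>W y + V y\<bar>) / D * K"
        using D y Y(2) f by (intro mult_left_mono) auto
      finally show "\<bar>(\<phi> (inv t \<otimes> y) - \<phi> y) * f y\<bar> \<le> (\<bar>W y - V y\<bar> * \<bar>W y + V y\<bar>) * (K / D)" by simp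
    qed
    also have "\<dots> \<le> \<epsilon> * D * (K / D)"
      unfolding sum_distrib_right[symmetric] using l1 K D by (intro mult_right_mono) auto
    also have "\<dots> = \<epsilon> * K" using D by simp
    finally show ?thesis by (simp add: t_def)
  qed
  moreover have "(\<Sum>x\<in>X. \<phi> x) = 1"
    using sumX D by (simp add: \<phi>_def flip: sum_divide_distrib)
  moreover have "\<forall>x\<in>X. 0 \<le> \<phi> x" using D by (simp add: \<phi>_def)
  ultimately show "\<exists>X \<phi>. finite X \<and> X \<subseteq> carrier G \<and> (\<forall>x\<in>X. 0 \<le> \<phi> x) \<and> (\<Sum>x\<in>X. \<phi> x) = 1 \<and>
      (\<forall>s\<in>T. \<forall>f K. (\<forall>x\<in>carrier G. \<bar>f x\<bar> \<le> K) \<longrightarrow>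
         \<bar>(\<Sum>x\<in>X. \<phi> x * f (inv s \<otimes> x)) - (\<Sum>x\<in>X. \<phi> x * f x)\<bar> \<le> \<epsilon> * K)"
    using X by (intro exI[of _ X] exI[of _ \<phi>]) auto
qed

text \<open>If every quotient stayed below \<open>1 - \<delta>\<close>, the number of closed words would be exponentially small
relative to \<open>card T ^ (2 * n)\<close>. But at time \<open>n = k * m\<close>, with \<open>m\<close> large, at least half of the words end in the ball of
radius \<open>m\<close>, which has at most \<open>card T ^ m\<close> elements, and the Cauchy-Schwarz inequality then gives a
lower bound that decays arbitrarily slowly as \<open>k\<close> grows.\<close>

lemma ratio_if_slow:
  fixes len :: "'g \<Rightarrow> nat"
  assumes slow: "\<And>\<eta>. \<eta> > 0 \<Longrightarrow>
      \<exists>N. \<forall>n. (\<Sum>w\<in>words n. real (len (endpoint w))) \<le> (\<eta> * real n + N) * real (card T ^ n)"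
    and ball: "\<And>m. card {g \<in> carrier G. len g \<le> m} \<le> card T ^ m"
    and fin: "\<And>m. finite {g \<in> carrier G. len g \<le> m}"
    and \<delta>: "0 < \<delta>" "\<delta> < 1"
  shows "\<exists>n. (1 - \<delta>) * real (card T ^ 2) * visits (n + n) \<one> \<le> visits (n + (2 + n)) \<one>"
proof (rule ccontr)
  define q where "q = real (card T)"
  have q: "q \<ge> 1" using card_T_pos by (simp add: q_def)
  assume "\<not> ?thesis"
  hence step: "visits (n + (2 + n)) \<one> \<le> (1 - \<delta>) * q\<^sup>2 * visits (n + n) \<one>" for n
    by (auto simp: q_def not_le intro: less_imp_le)
  have decay: "visits (n + n) \<one> \<le> (1 - \<delta>) ^ n * (q ^ n)\<^sup>2" for n
  proof (induction n)
    case 0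
    show ?case by (simp add: visits_zero_one)
  next
    case (Suc n)
    have "visits (Suc n + Suc n) \<one> \<le> (1 - \<delta>) * q\<^sup>2 * visits (n + n) \<one>"
      using step[of n] by simp
    also have "\<dots> \<le> (1 - \<delta>) * q\<^sup>2 * ((1 - \<delta>) ^ n * (q ^ n)\<^sup>2)"
      using Suc \<delta> by (intro mult_left_mono) auto
    finally show ?case by (simp add: power2_eq_square algebra_simps)
  qed
  \<comment> \<open>\<open>k\<close> makes the assumed decay over \<open>k\<close> steps beat the growth of balls by a factor \<open>2\<close> per unit of radius.\<close>
  obtain k where k: "(1 - \<delta>) ^ k < 1 / (2 * q)"
    using real_arch_pow_inv[of "1 / (2 * q)" "1 - \<delta>"] \<delta> q by auto
  have k0: "k > 0" using k q by (cases k) (auto simp: field_simps)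
  obtain N where N: "\<And>n. (\<Sum>w\<in>words n. real (len (endpoint w))) \<le> (1 / (4 * real k) * real n + N) * q ^ n"
    using slow[of "1 / (4 * real k)"] k0 by (auto simp: q_def)
  \<comment> \<open>\<open>m \<ge> 3\<close> makes \<open>1/4 \<le> (1/2) ^ m\<close> false; \<open>m \<ge> 4 * N\<close> absorbs the constant in the mean distance.\<close>
  obtain m :: nat where m: "max 3 (4 * N) \<le> real m" using real_arch_simple by blast
  hence m3: "m \<ge> 3" and mN: "N \<le> real m / 4" by auto
  define n where "n = k * m"
  define V where "V = visits n"
  define X where "X = {g \<in> reach n. len g \<le> m}"
  \<comment> \<open>Markov's inequality turns this mean into a bound for the number of words that end far away.\<close>
  have mean: "(\<Sum>w\<in>words n. real (len (endpoint w))) \<le> real m / 2 * q ^ n"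
  proof -
    have "(\<Sum>w\<in>words n. real (len (endpoint w))) \<le> (1 / (4 * real k) * real n + N) * q ^ n" by (rule N)
    also have "\<dots> \<le> real m / 2 * q ^ n"
      using mN k0 q by (intro mult_right_mono) (auto simp: n_def)
    finally show ?thesis .
  qed
  define near far where "near = {w \<in> words n. len (endpoint w) \<le> m}"
    and "far = {w \<in> words n. \<not> len (endpoint w) \<le> m}"
  have nf: "near \<union> far = words n" "near \<inter> far = {}" "finite near" "finite far"
    by (auto simp: near_def far_def)
  have "real m * real (card far) = (\<Sum>w\<in>far. real m)" by simp
  also have "\<dots> \<le> (\<Sum>w\<in>far. real (len (endpoint w)))" by (rule sum_mono) (auto simp: far_def)
  also have "\<dots> \<le> (\<Sum>w\<in>words n. real (len (endpoint w)))"
    by (rule sum_mono2) (auto simp: far_def)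
  also have "\<dots> \<le> real m * (q ^ n / 2)" using mean by simp
  finally have "real (card far) \<le> q ^ n / 2" using m3 by simp
  moreover have "real (card near) + real (card far) = q ^ n"
    using card_Un_disjoint[OF nf(3,4,2)] unfolding nf(1) card_words
    by (simp add: q_def flip: of_nat_add of_nat_power)
  ultimately have near: "q ^ n / 2 \<le> real (card near)" by simp
  have "real (card near) = (\<Sum>w\<in>words n. if len (endpoint w) \<le> m then 1 else 0)"
    unfolding near_def by (simp add: sum.inter_filter[symmetric])
  also have "\<dots> = (\<Sum>g\<in>reach n. V g * (if len g \<le> m then 1 else 0))"
    unfolding V_def by (rule sum_visits[symmetric]) auto
  also have "\<dots> = (\<Sum>g\<in>X. V g * 1)"
    unfolding X_def by (subst sum.inter_filter) (auto intro!: sum.cong)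
  finally have cn: "real (card near) = (\<Sum>g\<in>X. V g * 1)" .
  have cX: "real (card X) \<le> q ^ m"
  proof -
    have "card X \<le> card {g \<in> carrier G. len g \<le> m}"
      using reach_carrier by (intro card_mono fin) (auto simp: X_def)
    also have "\<dots> \<le> card T ^ m" by (rule ball)
    finally show ?thesis unfolding q_def of_nat_power[symmetric] of_nat_le_iff .
  qed
  have "(q ^ n / 2)\<^sup>2 \<le> (real (card near))\<^sup>2" using near q by (intro power_mono) auto
  also have "\<dots> \<le> (\<Sum>g\<in>X. (V g)\<^sup>2) * (\<Sum>g\<in>X. 1\<^sup>2)" unfolding cn by (rule Cauchy_Schwarz_ineq_sum)
  also have "\<dots> \<le> visits (n + n) \<one> * q ^ m"
  proof (rule mult_mono)
    have "(\<Sum>g\<in>X. (V g)\<^sup>2) \<le> (\<Sum>g\<in>reach n. (V g)\<^sup>2)"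
      by (rule sum_mono2) (auto simp: X_def)
    also have "\<dots> = visits (n + n) \<one>"
      unfolding V_def power2_eq_square by (intro sum_visits_mult) auto
    finally show "(\<Sum>g\<in>X. (V g)\<^sup>2) \<le> visits (n + n) \<one>" .
  qed (use cX in auto)
  also have "\<dots> \<le> ((1 - \<delta>) ^ n * (q ^ n)\<^sup>2) * q ^ m"
    using decay[of n] q by (intro mult_right_mono) auto
  also have "\<dots> = (q * (1 - \<delta>) ^ k) ^ m * (q ^ n)\<^sup>2"
    by (simp add: n_def power_mult power_mult_distrib)
  also have "\<dots> \<le> (1 / 2) ^ m * (q ^ n)\<^sup>2"
    using k q \<delta> by (intro mult_right_mono power_mono) (auto simp: field_simps)
  also have "\<dots> \<le> (1 / 2) ^ 3 * (q ^ n)\<^sup>2"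
    using m3 by (intro mult_right_mono power_decreasing) auto
  finally have "(q ^ n)\<^sup>2 \<le> 0" by (simp add: power_divide)
  moreover have "(q ^ n)\<^sup>2 > 0" using q by simp
  ultimately show False by linarith
qed

end

section \<open>Word length and the amenability criterion\<close>

context symmetric_walk begin

lemma generate_word:
  assumes "g \<in> generate G S" "S \<subseteq> carrier G"
  shows "\<exists>ws. set ws \<subseteq> S \<union> m_inv G ` S \<and> endpoint ws = g"
  using assms(1)
proof (induction rule: generate.induct)
  case one
  show ?case by (rule exI[of _ "[]"]) simp
next
  case (incl h)
  then show ?case using assms(2) by (intro exI[of _ "[h]"]) auto
next
  case (inv h)
  then show ?case using assms(2) by (intro exI[of _ "[inv h]"]) auto
next
  case (eng g h)
  then obtain u w where "set u \<subseteq> S \<union> m_inv G ` S" "endpoint u = g"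
    "set w \<subseteq> S \<union> m_inv G ` S" "endpoint w = h" by blast
  moreover have "S \<union> m_inv G ` S \<subseteq> carrier G" using assms(2) by auto
  ultimately show ?case
    using endpoint_append[of u w] by (intro exI[of _ "u @ w"]) (simp add: subset_trans)
qed

text \<open>A shortest word over the generators can be padded with \<open>\<one>\<close> to any larger length.\<close>

lemma word_length_le_imp_reach:
  assumes S: "S \<subseteq> carrier G" "S \<union> m_inv G ` S \<subseteq> T"
    and g: "g \<in> generate G S" "word_length G S g \<le> m"
  shows "g \<in> reach m"
proof -
  let ?P = "\<lambda>n. \<exists>ws. length ws = n \<and> set ws \<subseteq> S \<union> m_inv G ` S \<and> foldr (\<otimes>) ws \<one> = g"
  have "\<exists>n. ?P n" using generate_word[OF g(1) S(1)] by (auto simp: endpoint_def)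
  hence "?P (word_length G S g)" unfolding word_length_def by (rule LeastI_ex)
  then obtain ws where "length ws = word_length G S g" "set ws \<subseteq> T" "endpoint ws = g"
    using S(2) unfolding endpoint_def by blast
  hence "g \<in> reach (word_length G S g)" by (auto simp: reach_def words_def)
  thus ?thesis using reach_mono[OF g(2)] by blast
qed

end

theorem theorem1p4:
  fixes \<Gamma> :: "('g, 'm) monoid_scheme"
    and S :: "'g set"
    and p :: real
    and \<pi> :: "'g \<Rightarrow> 'b::banach \<Rightarrow>\<^sub>L 'b"
    and b :: "'g \<Rightarrow> 'b"
  assumes "group \<Gamma>"
    and "finite_generating_set \<Gamma> S"
    and "1 < p" and "p \<le> 2"
    and "p_uniformly_smooth p TYPE('b)"
    and "representation \<Gamma> \<pi>"
    and "uniformly_bounded \<Gamma> \<pi>"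
    and "cocycle \<Gamma> \<pi> b"
    and "\<forall>\<epsilon>>0. \<exists>F. finite F \<and> F \<subseteq> carrier \<Gamma> \<and>
           (\<forall>g\<in>carrier \<Gamma> - F. real (word_length \<Gamma> S g) powr (1 / p) \<le> \<epsilon> * norm (b g))"
  shows "amenable \<Gamma>"
proof -
  interpret group \<Gamma> by fact
  have S: "finite S" "S \<subseteq> carrier \<Gamma>" "generate \<Gamma> S = carrier \<Gamma>"
    using assms(2) by (auto simp: finite_generating_set_def)
  define T where "T = insert \<one>\<^bsub>\<Gamma>\<^esub> (S \<union> m_inv \<Gamma> ` S)"
  have ST: "S \<union> m_inv \<Gamma> ` S \<subseteq> T" by (auto simp: T_def)
  obtain L where L: "\<And>g. g \<in> carrier \<Gamma> \<Longrightarrow> norm (\<pi> g) \<le> L"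
    using assms(7) by (auto simp: uniformly_bounded_def bdd_above_def)
  interpret walk_cocycle \<Gamma> T \<pi> b L
  proof
    show "finite T" using S by (simp add: T_def)
    show "T \<subseteq> carrier \<Gamma>" using S by (auto simp: T_def)
    show "\<one>\<^bsub>\<Gamma>\<^esub> \<in> T" by (simp add: T_def)
    show "inv\<^bsub>\<Gamma>\<^esub> s \<in> T" if "s \<in> T" for s using that S(2) by (auto simp: T_def)
  qed (use assms L in auto)
  have T_gen: "generate \<Gamma> T = carrier \<Gamma>"
  proof
    show "generate \<Gamma> T \<subseteq> carrier \<Gamma>" using T_carrier by (rule generate_incl)
    have "generate \<Gamma> S \<subseteq> generate \<Gamma> T" using ST by (intro mono_generate) auto
    thus "carrier \<Gamma> \<subseteq> generate \<Gamma> T" using S by simp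
  qed
  let ?len = "word_length \<Gamma> S"
  obtain C where C: "C \<ge> 0"
    "\<And>n. (\<Sum>w\<in>words n. norm (b (endpoint w)) powr p) \<le> C * (real n + 1) * real (card T ^ n)"
    using cocycle_growth[OF assms(5,3,4)] by blast
  have slow: "\<exists>N. \<forall>n. (\<Sum>w\<in>words n. real (?len (endpoint w))) \<le> (\<eta> * real n + N) * real (card T ^ n)"
    if \<eta>: "\<eta> > 0" for \<eta>
  proof -
    \<comment> \<open>The factor \<open>e powr (1 / p)\<close> in the hypothesis becomes \<open>e\<close> for \<open>p\<close>-th powers, and \<open>e * C \<le> \<eta>\<close>.\<close>
    define e where "e = \<eta> / (C + 1)"
    have e: "e > 0" "e * C \<le> \<eta>" using \<eta> C(1) by (simp_all add: e_def field_simps)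
    obtain F where F: "finite F" "F \<subseteq> carrier \<Gamma>"
      "\<And>g. g \<in> carrier \<Gamma> - F \<Longrightarrow> real (?len g) powr (1 / p) \<le> e powr (1 / p) * norm (b g)"
      using assms(9)[THEN spec, of "e powr (1 / p)"] e by auto
    define N where "N = (\<Sum>g\<in>F. real (?len g))"
    have bound: "real (?len g) \<le> N + e * norm (b g) powr p" if g: "g \<in> carrier \<Gamma>" for g
    proof (cases "g \<in> F")
      case True
      have "real (?len g) \<le> N" unfolding N_def by (rule member_le_sum[OF True]) (use F in auto)
      thus ?thesis using e by (simp add: add_increasing2)
    next
      case False
      have "(real (?len g) powr (1 / p)) powr p \<le> (e powr (1 / p) * norm (b g)) powr p"
        using assms(3) False g F(3) by (intro powr_mono2) auto
      hence "real (?len g) \<le> e * norm (b g) powr p"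
        using assms(3) e by (simp add: powr_mult powr_powr)
      moreover have "N \<ge> 0" by (simp add: N_def sum_nonneg)
      ultimately show ?thesis by simp
    qed
    have "(\<Sum>w\<in>words n. real (?len (endpoint w))) \<le> (\<eta> * real n + (N + \<eta>)) * real (card T ^ n)" for n
    proof -
      have "(\<Sum>w\<in>words n. real (?len (endpoint w))) \<le> (\<Sum>w\<in>words n. N + e * norm (b (endpoint w)) powr p)"
        using words_carrier by (intro sum_mono bound) auto
      also have "\<dots> = N * real (card T ^ n) + e * (\<Sum>w\<in>words n. norm (b (endpoint w)) powr p)"
        by (simp add: sum.distrib card_words flip: sum_distrib_left)
      also have "\<dots> \<le> N * real (card T ^ n) + e * (C * (real n + 1) * real (card T ^ n))"
        using e C(2) by (intro add_left_mono mult_left_mono) auto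
      also have "\<dots> = N * real (card T ^ n) + (e * C) * ((real n + 1) * real (card T ^ n))"
        by (simp only: mult.assoc)
      also have "\<dots> \<le> N * real (card T ^ n) + \<eta> * ((real n + 1) * real (card T ^ n))"
        using e by (intro add_left_mono mult_right_mono) auto
      also have "\<dots> = (\<eta> * real n + (N + \<eta>)) * real (card T ^ n)" by (simp add: algebra_simps)
      finally show ?thesis .
    qed
    thus ?thesis by blast
  qed
  have ball: "{g \<in> carrier \<Gamma>. ?len g \<le> m} \<subseteq> reach m" for m
    using word_length_le_imp_reach[OF S(2) ST] S(3) by auto
  have "almost_invariant_measures \<Gamma> T"
  proof (rule almost_invariant_measures_if_ratio, rule ratio_if_slow[where len = ?len])
    show "card {g \<in> carrier \<Gamma>. ?len g \<le> m} \<le> card T ^ m" for m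
      using card_mono[OF finite_reach ball] card_reach by (rule order_trans)
    show "finite {g \<in> carrier \<Gamma>. ?len g \<le> m}" for m
      using ball by (rule finite_subset) simp
  qed (use slow in auto)
  thus ?thesis
    using amenable_if_almost_invariant_measures[OF assms(1) _ T_carrier inv_T T_gen] by blast
qed

end
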